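(* Let $n\ge 1$ and $\varepsilon > 0$. Let $A_{DR} = \boldsymbol{\Pi}_1 - \lambda^* \mathbf{I}$ and $A_\varepsilon = \boldsymbol{\Pi}_1 - \lambda^* \mathbf{I} - \varepsilon \boldsymbol{\Pi}_3$ as operators on $L^2(\gamma)$, where $\gamma$ is the standard Gaussian measure on $\mathbb{R}^n$. Then $$\mathrm{val}(A_\varepsilon) \le \mathrm{val}(A_{DR}) - \varepsilon\left(0.046 - 12(2\varepsilon)^{1/4}\right).$$
   Context: Let $\gamma=\gamma^{(n)}$ be the standard Gaussian measure on $\mathbb{R}^n$, with $\langle f,g\rangle_\gamma=\mathbb{E}_{X\sim\gamma}f(X)g(X)$. For a multi-index $\alpha\in\mathbb{N}^n$ let $\mathrm{He}_\alpha$ be the (probabilists') Hermite polynomial, $|\alpha|=\sum_i\alpha_i$. $\boldsymbol{\Pi}_k$ is the orthogonal projection of $L^2(\gamma)$ onto $\mathrm{span}\{\mathrm{He}_\alpha : |\alpha|=k\}$, and $\mathbf{I}$ is the identity. For a bounded operator $A$ on $L^2(\gamma)$, $$\mathrm{val}(A) = \sup_{f,g:\mathbb{R}^n\to\{\pm1\}} \mathbb{E}_{X\sim\gamma}\,(Af)(X)\,g(X),$$ the supremum being over measurable functions. With $\phi(x) = \frac{1}{\sqrt{2\pi}}e^{-x^2/2}$ and $\Phi(x) = \int_{-\infty}^x \phi(t)\, dt$, $C^*\approx 0.25573$ is the unique solution in $(0,1)$ of $4\phi(C)^2 - 4\Phi(-C) + 1 = 0$, and $\lambda^* = 2C^*\phi(C^*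 )\approx 0.19748$. *)

theory Defs
  imports
    "HOL-Probability.Probability"
    "HOL-Computational_Algebra.Polynomial"
begin

text \<open>
  Elements of \<open>L\<^sup>2(\<gamma>)\<close> are represented by Borel functions on \<open>real ^ 'n\<close>, and operators by maps
  on such functions. Nothing below depends on the choice of representatives modulo \<open>\<gamma>\<close>-null sets.
\<close>

definition std_gaussian :: "(real ^ 'n) measure" where
  "std_gaussian = density lborel (\<lambda>x. ennreal (\<Prod>i\<in>UNIV. std_normal_density (x $ i)))"

definition gauss_inner :: "(real ^ 'n \<Rightarrow> real) \<Rightarrow> (real ^ 'n \<Rightarrow> real) \<Rightarrow> real" where
  "gauss_inner f g = (\<integral>x. f x * g x \<partial>std_gaussian)"

fun He :: "nat \<Rightarrow> real poly" where
  "He 0 = 1"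
| "He (Suc 0) = [:0, 1:]"
| "He (Suc (Suc k)) = [:0, 1:] * He (Suc k) - smult (real (Suc k)) (He k)"

definition He_multi :: "('n::finite \<Rightarrow> nat) \<Rightarrow> real ^ 'n \<Rightarrow> real" where
  "He_multi \<alpha> x = (\<Prod>i\<in>UNIV. poly (He (\<alpha> i)) (x $ i))"

definition multi_indices :: "nat \<Rightarrow> ('n::finite \<Rightarrow> nat) set" where
  "multi_indices k = {\<alpha>. (\<Sum>i\<in>UNIV. \<alpha> i) = k}"

text \<open>The linear span of the finite family of all \<open>He_multi \<alpha>\<close> with \<open>\<bar>\<alpha>\<bar> = k\<close>.\<close>

definition hermite_span :: "nat \<Rightarrow> (real ^ 'n \<Rightarrow> real) set" where
  "hermite_span k = range (\<lambda>c x. \<Sum>\<alpha>\<in>multi_indices k. c \<alpha> * He_multi \<alpha> x)"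

text \<open>
  For square-integrable \<open>f\<close> the projection exists because the span is finite-dimensional. It is
  unique even as a pointwise function, since polynomials that agree \<open>\<gamma>\<close>-almost everywhere are equal.
\<close>

definition hermite_proj :: "nat \<Rightarrow> (real ^ 'n \<Rightarrow> real) \<Rightarrow> real ^ 'n \<Rightarrow> real" where
  "hermite_proj k f =
     (THE h. h \<in> hermite_span k \<and> (\<forall>p\<in>hermite_span k. gauss_inner (\<lambda>x. f x - h x) p = 0))"

definition sign_functions :: "(real ^ 'n \<Rightarrow> real) set" where
  "sign_functions = {f \<in> borel_measurable borel. \<forall>x. f x \<in> {-1, 1}}"

text \<open>
  For an operator bounded on \<open>L\<^sup>2(\<gamma>)\<close> the values are bounded by the operator norm, so the
  real-valued supremum is the genuine one.
\<close>

definition val :: "((real ^ 'n \<Rightarrow> real) \<Rightarrow> real ^ 'n \<Rightarrow> real) \<Rightarrow> real" where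
  "val A = (SUP (f, g) \<in> sign_functions \<times> sign_functions. gauss_inner (A f) g)"

definition Phi :: "real \<Rightarrow> real" where
  "Phi x = (LINT t:{..x}|lborel. std_normal_density t)"

text \<open>
  The left-hand side is strictly increasing in \<open>C\<close> on \<open>[0, 1]\<close>, negative at \<open>0\<close> and positive at \<open>1\<close>.
\<close>

definition C_star :: real where
  "C_star = (THE C. 0 < C \<and> C < 1 \<and> 4 * (std_normal_density C)\<^sup>2 - 4 * Phi (- C) + 1 = 0)"

definition lambda_star :: real where
  "lambda_star = 2 * C_star * std_normal_density C_star"

end

theory Submission
  imports Defs "HOL-Real_Asymp.Real_Asymp"
begin

text \<open>
  Write \<open>a = (f + g) / 2\<close> and \<open>b = (f - g) / 2\<close>; these have disjoint supports and values in \<open>{-1, 0, 1}\<close>, and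
  \<open>\<langle>\<Pi>\<^sub>k f, g\<rangle> = \<parallel>\<Pi>\<^sub>k a\<parallel>\<^sup>2 - \<parallel>\<Pi>\<^sub>k b\<parallel>\<^sup>2\<close>. Rotate so that the barycentre of \<open>a\<close> lies on the positive \<open>i\<close>-th axis. For
  \<open>A\<^sub>D\<^sub>R\<close> the best choice is \<open>a* = sgn x\<^sub>i\<close> off the strip \<open>S = {\<bar>x\<^sub>i\<bar> < C*}\<close> and \<open>a* = 0\<close> on \<open>S\<close>. The linearized loss
  \<open>\<rho> = E[(a* x\<^sub>i - C* \<bar>a*\<bar>) - (a x\<^sub>i - C* \<bar>a\<bar>)] \<ge> 0\<close> controls both \<open>E (a - a*)\<^sup>2 = O(\<surd>\<rho>)\<close> and, because \<open>C*\<close> is small,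
  the deficit \<open>\<delta>\<close> of \<open>(f, g)\<close> for \<open>A\<^sub>D\<^sub>R\<close>: either \<open>\<delta> \<ge> \<rho> / 2\<close> or \<open>\<delta>\<close> exceeds an absolute constant.

  A pair with \<open>\<delta> \<ge> 2\<epsilon>\<close> cannot win, since \<open>\<langle>\<Pi>\<^sub>3 f, g\<rangle> \<ge> -1\<close>. Otherwise \<open>\<parallel>a - a*\<parallel> = O(\<epsilon>\<^bsup>1/4\<^esup>)\<close>. Then \<open>\<parallel>\<Pi>\<^sub>3 a\<parallel>\<close> is at least
  \<open>\<bar>\<langle>a*, He\<^sub>3(x\<^sub>i)\<rangle>\<bar> / \<surd>6\<close> up to \<open>O(\<epsilon>\<^bsup>1/4\<^esup>)\<close>, while \<open>\<parallel>\<Pi>\<^sub>3 b\<parallel>\<close> is at most \<open>P(S)\<close> up to \<open>O(\<epsilon>\<^bsup>1/4\<^esup>)\<close>: for \<open>h\<close> in the third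
  Hermite space \<open>E 1\<^sub>S h\<^sup>2 \<le> P(S) E h\<^sup>2\<close>, because \<open>He\<^sub>j\<^sup>2 \<le> j!\<close> on \<open>S\<close>. The difference of the squares of these two
  main terms is just above \<open>0.046\<close>.
\<close>

section \<open>The standard Gaussian measure\<close>

abbreviation gauss1 :: "real measure" where
  "gauss1 \<equiv> density lborel (\<lambda>x. ennreal (std_normal_density x))"

text \<open>Lebesgue measure is determined by its values on boxes, where both sides give the product
  of the side lengths. This makes integration over finite product measures available on
  \<open>real ^ 'n\<close>.\<close>

lemma lborel_eq_distr_vec:
  "(lborel :: (real ^ 'n) measure) = distr (\<Pi>\<^sub>M i\<in>UNIV. lborel) borel (\<lambda>f. \<chi> i. f i)"
proof (rule lborel_eqI)
  interpret product_sigma_finite "\<lambda>_::'n. lborel :: real measure" ..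
  have vec[measurable]: "(\<lambda>f. \<chi> i. f i) \<in> (\<Pi>\<^sub>M i\<in>(UNIV::'n set). (lborel :: real measure)) \<rightarrow>\<^sub>M borel"
    by (rule borel_measurable_euclidean_space[THEN iffD2]) (auto simp: Basis_vec_def inner_axis)
  fix l u :: "real ^ 'n"
  assume le: "\<And>b. b \<in> Basis \<Longrightarrow> l \<bullet> b \<le> u \<bullet> b"
  have le': "l $ i \<le> u $ i" for i
    using le[of "axis i 1"] by (auto simp: Basis_vec_def inner_axis)
  have "emeasure (distr (\<Pi>\<^sub>M i\<in>UNIV. lborel) borel (\<lambda>f. \<chi> i. f i)) (box l u)
      = emeasure (\<Pi>\<^sub>M i\<in>UNIV. lborel) (Pi\<^sub>E (UNIV::'n set) (\<lambda>i. {l $ i <..< u $ i}))"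
    by (subst emeasure_distr)
      (auto simp: mem_box Basis_vec_def inner_axis space_PiM PiE_def Pi_iff intro!: arg_cong[where f = "emeasure _"])
  also have "\<dots> = (\<Prod>i\<in>UNIV. ennreal (u $ i - l $ i))"
    by (subst emeasure_PiM) (auto simp: le')
  also have "\<dots> = ennreal (\<Prod>i\<in>UNIV. u $ i - l $ i)"
    by (rule prod_ennreal) (simp add: le')
  also have "(\<Prod>i\<in>UNIV. u $ i - l $ i) = (\<Prod>b\<in>Basis. (u - l) \<bullet> b)"
  proof -
    have "bij_betw (\<lambda>i. axis i 1 :: real ^ 'n) UNIV Basis"
      by (auto simp: bij_betw_def inj_def axis_eq_axis Basis_vec_def)
    from prod.reindex_bij_betw[OF this, of "\<lambda>b. (u - l) \<bullet> b"] show ?thesis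
      by (simp add: inner_axis)
  qed
  finally show "emeasure (distr (\<Pi>\<^sub>M i\<in>UNIV. lborel) borel (\<lambda>f. \<chi> i. f i)) (box l u)
      = ennreal (\<Prod>b\<in>Basis. (u - l) \<bullet> b)" .
qed simp

lemma sets_std_gaussian [measurable_cong, simp]: "sets std_gaussian = sets borel"
  by (simp add: std_gaussian_def)

lemma space_std_gaussian [simp]: "space std_gaussian = UNIV"
  by (simp add: std_gaussian_def)

text \<open>Independence of the coordinates under the Gaussian. The explicit multivariate integrals
  below are reduced to one-dimensional ones through this rule.\<close>

lemma has_bochner_integral_gauss_prod:
  fixes F :: "'n::finite \<Rightarrow> real \<Rightarrow> real"
  assumes F: "\<And>i. integrable gauss1 (F i)"
  shows "has_bochner_integral std_gaussian (\<lambda>x. \<Prod>i\<in>UNIV. F i (x $ i)) (\<Prod>i\<in>UNIV. \<integral>x. F i x \<partial>gauss1)"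
proof -
  interpret product_sigma_finite "\<lambda>_::'n. lborel :: real measure" ..
  have vec[measurable]: "(\<lambda>f. \<chi> i. f i) \<in> (\<Pi>\<^sub>M i\<in>(UNIV::'n set). (lborel :: real measure)) \<rightarrow>\<^sub>M borel"
    by (rule borel_measurable_euclidean_space[THEN iffD2]) (auto simp: Basis_vec_def inner_axis)
  have [measurable]: "F i \<in> borel_measurable borel" for i
    using borel_measurable_integrable[OF F[of i]] by simp
  have G: "integrable lborel (\<lambda>x. std_normal_density x * F i x)" for i
    using F[of i] by (subst (asm) integrable_density) auto
  have Gi: "(\<integral>x. F i x \<partial>gauss1) = (\<integral>x. std_normal_density x * F i x \<partial>lborel)" for i
    by (subst integral_density) auto
  have 1: "integrable (\<Pi>\<^sub>M i\<in>UNIV. lborel) (\<lambda>f. \<Prod>i\<in>(UNIV::'n set). std_normal_density (f i) * F i (f i))"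
    by (rule product_integrable_prod) (auto intro: G)
  have 2: "(\<integral>f. (\<Prod>i\<in>(UNIV::'n set). std_normal_density (f i) * F i (f i)) \<partial>(\<Pi>\<^sub>M i\<in>UNIV. lborel))
     = (\<Prod>i\<in>UNIV. \<integral>x. F i x \<partial>gauss1)"
    unfolding Gi by (rule product_integral_prod) (auto intro: G)
  have "has_bochner_integral lborel (\<lambda>x :: real ^ 'n. \<Prod>i\<in>UNIV. std_normal_density (x $ i) * F i (x $ i))
     (\<Prod>i\<in>UNIV. \<integral>x. F i x \<partial>gauss1)"
    unfolding lborel_eq_distr_vec
    using 1 2 by (simp add: has_bochner_integral_iff integrable_distr_eq integral_distr)
  then show ?thesis
    unfolding std_gaussian_def
    by (intro has_bochner_integral_density) (auto simp: prod.distrib intro!: prod_nonneg AE_I2)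
qed

section \<open>Invariance of the Lebesgue and Gaussian measures under orthogonal maps\<close>

lemma std_gaussian_eq_norm:
  "std_gaussian = density lborel (\<lambda>x :: real ^ 'n. ennreal (exp (- (norm x)\<^sup>2 / 2) / sqrt (2 * pi) ^ CARD('n)))"
proof -
  have "(\<Prod>i\<in>UNIV. std_normal_density (x $ i)) = exp (- (norm x)\<^sup>2 / 2) / sqrt (2 * pi) ^ CARD('n)" for x :: "real ^ 'n"
    by (simp add: std_normal_density_def prod.distrib prod_dividef power_one_over exp_sum[symmetric] norm_vec_def L2_set_def
        sum_nonneg sum_negf sum_divide_distrib)
  then show ?thesis
    by (simp add: std_gaussian_def)
qed

lemma borel_measurable_orthogonal:
  fixes R :: "'a::euclidean_space \<Rightarrow> 'a"
  assumes R: "orthogonal_transformation R"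
  shows "R \<in> borel_measurable borel"
  using orthogonal_transformation_linear[OF R]
  by (intro borel_measurable_continuous_onI linear_continuous_on linear_conv_bounded_linear[THEN iffD1])

text \<open>
  Translation invariance of Lebesgue measure, used once on each side of Fubini's theorem,
  gives \<open>\<lambda>(R\<inverse> A) \<lambda>(B) = \<lambda>(A) \<lambda>(R\<inverse> B)\<close>; the unit ball \<open>B\<close> is invariant under \<open>R\<close>.
\<close>

lemma distr_lborel_orthogonal:
  fixes R :: "'a::euclidean_space \<Rightarrow> 'a"
  assumes R: "orthogonal_transformation R"
  shows "distr lborel borel R = lborel"
proof (rule measure_eqI)
  note [measurable] = borel_measurable_orthogonal[OF R]
  have lin: "linear R" and surj: "surj R"
    using R by (auto simp: orthogonal_transformation_linear orthogonal_transformation_surj)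
  obtain Q where Q: "R (Q y) = y" for y
    using surj by (metis surj_f_inv_f)
  fix A assume "A \<in> sets (distr lborel borel R)"
  then have [measurable]: "A \<in> sets borel" by simp
  define B where "B = ball (0::'a) 1"
  have [measurable]: "B \<in> sets borel"
    by (simp add: B_def)
  let ?L = "lborel :: 'a measure"
  have shift: "(\<integral>\<^sup>+x. g (x + c) \<partial>?L) = (\<integral>\<^sup>+x. g x \<partial>?L)" if [measurable]: "g \<in> borel_measurable borel"
    for c and g :: "'a \<Rightarrow> ennreal"
  proof -
    have "(\<integral>\<^sup>+x. g x \<partial>?L) = (\<integral>\<^sup>+x. g x \<partial>distr ?L borel ((+) c))"
      by (simp add: lborel_distr_plus)
    also have "\<dots> = (\<integral>\<^sup>+x. g (x + c) \<partial>?L)"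
      by (subst nn_integral_distr) (auto simp: add.commute)
    finally show ?thesis ..
  qed
  have ball_shift: "(\<integral>\<^sup>+y. indicator B (z - y) \<partial>?L) = emeasure ?L B" for z
  proof -
    have "(\<integral>\<^sup>+y. indicator B (z - y) \<partial>?L) = (\<integral>\<^sup>+y. indicator B (z - (y + z)) \<partial>?L)"
      by (rule shift[symmetric]) measurable
    also have "\<dots> = (\<integral>\<^sup>+y. indicator B y \<partial>?L)"
      by (intro nn_integral_cong) (auto simp: indicator_def B_def)
    finally show ?thesis by simp
  qed
  have 1: "(\<integral>\<^sup>+x. \<integral>\<^sup>+y. indicator A (R x) * indicator B (R x - y) \<partial>?L \<partial>?L)
      = emeasure (distr ?L borel R) A * emeasure ?L B"
  proof -
    have "(\<integral>\<^sup>+x. indicator A (R x) \<partial>?L) = emeasure (distr ?L borel R) A"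
      by (subst nn_integral_distr[of R ?L borel "indicator A", symmetric]) auto
    then show ?thesis
      by (simp add: nn_integral_cmult ball_shift nn_integral_multc)
  qed
  have "(\<integral>\<^sup>+x. \<integral>\<^sup>+y. indicator A (R x) * indicator B (R x - y) \<partial>?L \<partial>?L)
      = (\<integral>\<^sup>+y. \<integral>\<^sup>+x. indicator A (R x) * indicator B (R x - y) \<partial>?L \<partial>?L)"
    by (rule lborel_pair.Fubini'[symmetric]) measurable
  \<comment> \<open>Translating by a preimage \<open>Q y\<close> of \<open>y\<close> removes
    \<open>y\<close> from the argument of the ball and moves it into that of
    \<open>A\<close>.\<close>
  also have "\<dots> = (\<integral>\<^sup>+y. \<integral>\<^sup>+x. indicator A (R (x + Q y)) * indicator B (R (x + Q y) - y) \<partial>?L \<partial>?L)"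
    by (intro nn_integral_cong shift[symmetric]) measurable
  also have "\<dots> = (\<integral>\<^sup>+y. \<integral>\<^sup>+x. indicator A (y + R x) * indicator B x \<partial>?L \<partial>?L)"
    using R by (intro nn_integral_cong)
      (auto simp: linear_add[OF lin] Q add.commute indicator_def B_def orthogonal_transformation_norm)
  also have "\<dots> = (\<integral>\<^sup>+x. \<integral>\<^sup>+y. indicator A (y + R x) * indicator B x \<partial>?L \<partial>?L)"
    by (rule lborel_pair.Fubini') measurable
  also have "\<dots> = emeasure ?L A * emeasure ?L B"
    by (simp add: nn_integral_multc shift[of "indicator A"] nn_integral_cmult)
  finally have "emeasure (distr ?L borel R) A * emeasure ?L B = emeasure ?L A * emeasure ?L B"
    unfolding 1 .
  \<comment> \<open>The ball has positive finite volume, so it can be cancelled from the product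
    identity.\<close>
  moreover have "emeasure ?L B \<noteq> 0" "emeasure ?L B \<noteq> \<infinity>"
    using emeasure_lborel_ball_finite[of 0 1] content_ball_pos[of 1 "0 :: 'a"]
    by (auto simp: measure_def B_def)
  ultimately show "emeasure (distr lborel borel R) A = emeasure lborel A"
    by (metis ennreal_mult_divide_eq infinity_ennreal_def)
qed simp

text \<open>Lebesgue measure is invariant under \<open>R\<close>, and the Gaussian density depends
  on the norm only.\<close>

lemma distr_std_gaussian_orthogonal:
  fixes R :: "real ^ 'n \<Rightarrow> real ^ 'n"
  assumes R: "orthogonal_transformation R"
  shows "distr std_gaussian borel R = std_gaussian"
proof -
  note [measurable] = borel_measurable_orthogonal[OF R]
  let ?d = "\<lambda>x :: real ^ 'n. ennreal (exp (- (norm x)\<^sup>2 / 2) / sqrt (2 * pi) ^ CARD('n))"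
  have "std_gaussian = density (distr lborel borel R) ?d"
    unfolding distr_lborel_orthogonal[OF R] std_gaussian_eq_norm ..
  also have "\<dots> = distr (density lborel (\<lambda>x. ?d (R x))) borel R"
    by (rule density_distr) auto
  also have "(\<lambda>x. ?d (R x)) = ?d"
    using R by (simp add: orthogonal_transformation_norm)
  finally show ?thesis
    by (simp add: std_gaussian_eq_norm)
qed

lemma integral_std_gaussian_orthogonal:
  fixes R :: "real ^ 'n \<Rightarrow> real ^ 'n" and f :: "real ^ 'n \<Rightarrow> real"
  assumes R: "orthogonal_transformation R" and f [measurable]: "f \<in> borel_measurable borel"
  shows "(\<integral>x. f (R x) \<partial>std_gaussian) = (\<integral>x. f x \<partial>std_gaussian)"
proof -
  note [measurable] = borel_measurable_orthogonal[OF R]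
  have "(\<integral>x. f x \<partial>std_gaussian) = (\<integral>x. f x \<partial>distr std_gaussian borel R)"
    by (simp add: distr_std_gaussian_orthogonal[OF R])
  also have "\<dots> = (\<integral>x. f (R x) \<partial>std_gaussian)"
    by (subst integral_distr) auto
  finally show ?thesis ..
qed

section \<open>Hermite polynomials and projections\<close>

lemma prob_space_gauss1: "prob_space gauss1"
  by (rule prob_space_normal_density) simp

lemma integrable_gauss1_iff:
  fixes f :: "real \<Rightarrow> real"
  assumes "f \<in> borel_measurable borel"
  shows "integrable gauss1 f \<longleftrightarrow> integrable lborel (\<lambda>x. std_normal_density x * f x)"
  using assms by (subst integrable_density) auto

lemma integral_gauss1:
  fixes f :: "real \<Rightarrow> real"
  assumes "f \<in> borel_measurable borel"
  shows "(\<integral>x. f x \<partial>gauss1) = (\<integral>x. std_normal_density x * f x \<partial>lborel)"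
  using assms by (subst integral_density) auto

lemma prob_space_std_gaussian: "prob_space (std_gaussian :: (real ^ 'n) measure)"
proof -
  interpret G: prob_space gauss1 by (rule prob_space_gauss1)
  have *: "has_bochner_integral (std_gaussian :: (real ^ 'n) measure) (\<lambda>x. 1) (1 :: real)"
    using has_bochner_integral_gauss_prod[of "\<lambda>(_::'n) _. 1"] G.prob_space by simp
  have "emeasure (std_gaussian :: (real ^ 'n) measure) UNIV = 1"
    using * nn_integral_eq_integral[of "std_gaussian :: (real ^ 'n) measure" "\<lambda>_. 1"]
    by (simp add: has_bochner_integral_iff del: lebesgue_integral_const)
  then show ?thesis
    by (intro prob_spaceI) simp
qed

section \<open>Gaussian moments, Stein's identity and Hermite polynomials in one variable\<close>

lemma integrable_gauss1_power: "integrable gauss1 (\<lambda>x. x ^ k)"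
  using integrable_std_normal_moment[of k] by (simp add: integrable_gauss1_iff)

lemma integrable_gauss1_poly: "integrable gauss1 (poly p)"
  unfolding poly_altdef by (intro Bochner_Integration.integrable_sum integrable_mult_right integrable_gauss1_power)

text \<open>Stein's identity on monomials, read off the closed forms of the moments:
  \<open>(2i)! / (2^i i!)\<close> in even order and 0 in odd order.\<close>

lemma gauss1_power_rec:
  "(\<integral>x. x ^ Suc (Suc k) \<partial>gauss1) = real (Suc k) * (\<integral>x. x ^ k \<partial>gauss1)"
proof (cases "even k")
  case True
  then obtain j where k: "k = 2 * j" by (elim evenE)
  have "(\<integral>x. x ^ (2 * i) \<partial>gauss1) = fact (2 * i) / (2 ^ i * fact i)" for i
    using integral_std_normal_moment_even[of i] by (simp add: integral_gauss1)
  note moment = this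
  have "(\<integral>x. x ^ Suc (Suc k) \<partial>gauss1) = (\<integral>x. x ^ (2 * Suc j) \<partial>gauss1)"
    by (simp add: k)
  also have "\<dots> = real (Suc k) * (fact (2 * j) / (2 ^ j * fact j))"
    unfolding moment k by (simp add: divide_simps)
  finally show ?thesis
    unfolding k moment .
next
  case False
  then obtain j where k: "k = 2 * j + 1" by (elim oddE)
  have "(\<integral>x. x ^ (2 * i + 1) \<partial>gauss1) = 0" for i
    using integral_std_normal_moment_odd[of i] by (simp add: integral_gauss1)
  from this[of j] this[of "Suc j"] show ?thesis
    by (simp add: k)
qed

lemma poly_induct_monom_add:
  fixes p :: "'a::comm_monoid_add poly"
  assumes "\<And>c n. Q (monom c n)" "\<And>p q. Q p \<Longrightarrow> Q q \<Longrightarrow> Q (p + q)"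
  shows "Q p"
proof -
  have "Q (\<Sum>i\<in>A. monom (coeff p i) i)" if "finite A" for A
    using that
  proof induction
    case empty
    show ?case using assms(1)[of 0] by simp
  qed (auto intro: assms)
  from this[of "{..degree p}"] show ?thesis
    by (simp add: poly_as_sum_of_monoms)
qed

text \<open>Gaussian integration by parts. Both sides are linear in \<open>p\<close>, so monomials
  suffice; there it is the moment recursion or, for constants, the vanishing first moment.\<close>

lemma gauss1_stein: "(\<integral>x. x * poly p x \<partial>gauss1) = (\<integral>x. poly (pderiv p) x \<partial>gauss1)"
proof (induction p rule: poly_induct_monom_add)
  case (1 c n)
  have "(\<integral>x. x ^ 1 \<partial>gauss1) = 0"
    using integral_std_normal_moment_odd[of 0] by (simp add: integral_gauss1)
  then show ?case
    using gauss1_power_rec[of "n - 1"]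
    by (cases n) (simp_all add: poly_monom pderiv_monom mult.left_commute[of _ c])
next
  case (2 p q)
  have i: "integrable gauss1 (\<lambda>x. x * poly r x)" for r
    using integrable_gauss1_poly[of "[:0, 1:] * r"] unfolding poly_mult by simp
  show ?case
    using 2 by (simp add: pderiv_add distrib_left Bochner_Integration.integral_add i integrable_gauss1_poly)
qed

text \<open>Differentiating the three-term recursion and using the claim for the two preceding
  indices reproduces the same recursion one index lower. This is why the induction is
  strong.\<close>

lemma pderiv_He: "pderiv (He (Suc k)) = smult (real (Suc k)) (He k)"
proof (induction k rule: less_induct)
  case (less k)
  show ?case
  proof (cases k)
    case 0
    then show ?thesis by (simp add: pderiv_pCons)
  next
    case (Suc j)
    have IH: "pderiv (He (Suc j)) = smult (real (Suc j)) (He j)"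
      using less Suc by blast
    show ?thesis
    proof (cases j)
      case 0
      then show ?thesis
        using Suc by (simp add: pderiv_diff pderiv_mult pderiv_pCons pderiv_smult numeral_poly)
    next
      case (Suc i)
      have IH': "pderiv (He j) = smult (real j) (He i)"
        using less[of i] Suc \<open>k = Suc j\<close> by simp
      have He_j: "He (Suc j) = [:0, 1:] * He j - smult (real j) (He i)"
        using Suc by simp
      have "pderiv (He (Suc (Suc j)))
          = He (Suc j) + [:0, 1:] * pderiv (He (Suc j)) - smult (real (Suc j)) (pderiv (He j))"
        by (simp only: He.simps(3)[of j] pderiv_diff pderiv_mult pderiv_smult) (simp add: pderiv_pCons)
      also have "\<dots> = He (Suc j) + smult (real (Suc j)) ([:0, 1:] * He j - smult (real j) (He i))"
        unfolding IH IH' by (simp only: mult_smult_right smult_diff_right smult_smult mult.commute)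
      also have "\<dots> = smult (real (Suc (Suc j))) (He (Suc j))"
        unfolding He_j[symmetric] by (simp only: of_nat_Suc smult_add_left) simp
      finally show ?thesis
        unfolding \<open>k = Suc j\<close> .
    qed
  qed
qed

text \<open>Raising the Hermite index is adjoint to differentiation. After
  \<open>gauss1_stein\<close> is applied to \<open>He (Suc k) * p\<close>, the derivative of the
  Hermite factor cancels the lower-order term of the recursion.\<close>

lemma gauss1_He_Suc_mult:
  "(\<integral>x. poly (He (Suc m)) x * poly p x \<partial>gauss1) = (\<integral>x. poly (He m) x * poly (pderiv p) x \<partial>gauss1)"
proof (cases m)
  case 0
  then show ?thesis using gauss1_stein[of p] by simp
next
  case (Suc k)
  have i: "integrable gauss1 (\<lambda>x. poly q x * poly r x)" "integrable gauss1 (\<lambda>x. x * poly q x)"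
      "integrable gauss1 (\<lambda>x. x * (poly q x * poly r x))" for q r
    using integrable_gauss1_poly[of "q * r"] integrable_gauss1_poly[of "[:0, 1:] * q"]
      integrable_gauss1_poly[of "[:0, 1:] * (q * r)"] unfolding poly_mult by simp_all
  have "(\<integral>x. poly (He (Suc m)) x * poly p x \<partial>gauss1)
      = (\<integral>x. x * poly (He (Suc k) * p) x - real (Suc k) * (poly (He k) x * poly p x) \<partial>gauss1)"
    using Suc by (simp add: algebra_simps)
  also have "\<dots> = (\<integral>x. x * poly (He (Suc k) * p) x \<partial>gauss1) - real (Suc k) * (\<integral>x. poly (He k) x * poly p x \<partial>gauss1)"
    using i by (subst Bochner_Integration.integral_diff) auto
  also have "(\<integral>x. x * poly (He (Suc k) * p) x \<partial>gauss1)
      = (\<integral>x. poly (He (Suc k)) x * poly (pderiv p) x + real (Suc k) * (poly (He k) x * poly p x) \<partial>gauss1)"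
    unfolding gauss1_stein
    by (intro Bochner_Integration.integral_cong refl) (simp add: pderiv_mult pderiv_He mult_ac del: He.simps(3))
  also have "\<dots> = (\<integral>x. poly (He (Suc k)) x * poly (pderiv p) x \<partial>gauss1) + real (Suc k) * (\<integral>x. poly (He k) x * poly p x \<partial>gauss1)"
    using i by (subst Bochner_Integration.integral_add) auto
  finally show ?thesis
    using Suc by simp
qed

text \<open>The adjoint relation lowers both indices at once and leaves the factor \<open>n\<close>;
  if one index reaches 0 first, the derivative of a constant remains.\<close>

lemma gauss1_He_orthogonal:
  "(\<integral>x. poly (He m) x * poly (He n) x \<partial>gauss1) = (if m = n then fact n else 0)"
proof (induction m arbitrary: n)
  case 0
  interpret prob_space gauss1 by (rule prob_space_gauss1)
  show ?case
  proof (cases n)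
    case 0
    then show ?thesis using prob_space by simp
  next
    case (Suc k)
    then show ?thesis
      using gauss1_He_Suc_mult[of k 1] by simp
  qed
next
  case (Suc m)
  show ?case
  proof (cases n)
    case 0
    then show ?thesis
      using gauss1_He_Suc_mult[of m 1] by simp
  next
    case (Suc k)
    then show ?thesis
      using Suc.IH[of k] by (simp add: gauss1_He_Suc_mult pderiv_He mult.left_commute[of _ "real (Suc k)"] del: He.simps(3) of_nat_Suc)
  qed
qed

section \<open>Multivariate Hermite polynomials and their spans of fixed degree\<close>

abbreviation mfact :: "('n::finite \<Rightarrow> nat) \<Rightarrow> real" where
  "mfact \<alpha> \<equiv> \<Prod>i\<in>UNIV. fact (\<alpha> i)"

lemma mfact_pos: "mfact \<alpha> > 0"
  by (intro prod_pos) simp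

lemma has_bochner_integral_He_multi:
  "has_bochner_integral std_gaussian (\<lambda>x. He_multi \<alpha> x * He_multi \<beta> x) (if \<alpha> = \<beta> then mfact \<alpha> else 0)"
proof -
  have "integrable gauss1 (\<lambda>x. poly (He (\<alpha> i)) x * poly (He (\<beta> i)) x)" for i
    using integrable_gauss1_poly[of "He (\<alpha> i) * He (\<beta> i)"] unfolding poly_mult .
  note * = has_bochner_integral_gauss_prod[of "\<lambda>i x. poly (He (\<alpha> i)) x * poly (He (\<beta> i)) x", OF this]
  have "(\<Prod>i\<in>UNIV. \<integral>x. poly (He (\<alpha> i)) x * poly (He (\<beta> i)) x \<partial>gauss1) = (if \<alpha> = \<beta> then mfact \<alpha> else 0)"
    by (auto simp: gauss1_He_orthogonal prod_zero_iff fun_eq_iff)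
  with * show ?thesis
    by (simp add: He_multi_def prod.distrib)
qed

lemma integrable_He_multi_mult: "integrable std_gaussian (\<lambda>x. He_multi \<alpha> x * He_multi \<beta> x)"
  by (rule integrable.intros[OF has_bochner_integral_He_multi])

lemma integrable_He_multi: "integrable std_gaussian (He_multi \<alpha>)"
  using integrable_He_multi_mult[of \<alpha> "\<lambda>_. 0"] by (simp add: He_multi_def[of "\<lambda>_. 0"])

lemma finite_multi_indices: "finite (multi_indices k :: ('n::finite \<Rightarrow> nat) set)"
proof (rule finite_subset)
  show "multi_indices k \<subseteq> Pi\<^sub>E (UNIV :: 'n set) (\<lambda>_. {..k})"
    by (auto simp: multi_indices_def intro!: member_le_sum)
qed (simp add: finite_PiE)

lemma multi_indices_1: "multi_indices 1 = range (\<lambda>i. (\<lambda>_. 0)(i := 1))"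
proof -
  have "\<alpha> \<in> range (\<lambda>i. (\<lambda>_. 0)(i := 1))" if "sum \<alpha> UNIV = 1" for \<alpha> :: "'a::finite \<Rightarrow> nat"
  proof -
    from that have "\<exists>i\<in>UNIV. \<alpha> i = 1 \<and> (\<forall>j\<in>UNIV. i \<noteq> j \<longrightarrow> \<alpha> j = 0)"
      by (simp only: sum_eq_1_iff finite)
    then obtain i where "\<alpha> i = 1" "\<And>j. i \<noteq> j \<Longrightarrow> \<alpha> j = 0"
      by blast
    then have "\<alpha> = (\<lambda>_. 0)(i := 1)" by auto
    then show ?thesis by blast
  qed
  then show ?thesis
    by (auto simp: multi_indices_def)
qed

lemma hermite_span_zero: "(\<lambda>_. 0) \<in> hermite_span k"
  unfolding hermite_span_def by (rule range_eqI[of _ _ "\<lambda>_. 0"]) simp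

lemma hermite_span_add: "g \<in> hermite_span k \<Longrightarrow> h \<in> hermite_span k \<Longrightarrow> (\<lambda>x. g x + h x) \<in> hermite_span k"
proof -
  assume "g \<in> hermite_span k" "h \<in> hermite_span k"
  then obtain c d where "g = (\<lambda>x. \<Sum>\<alpha>\<in>multi_indices k. c \<alpha> * He_multi \<alpha> x)"
     "h = (\<lambda>x. \<Sum>\<alpha>\<in>multi_indices k. d \<alpha> * He_multi \<alpha> x)"
    unfolding hermite_span_def by blast
  then have "(\<lambda>x. g x + h x) = (\<lambda>x. \<Sum>\<alpha>\<in>multi_indices k. (c \<alpha> + d \<alpha>) * He_multi \<alpha> x)"
    by (simp add: sum.distrib distrib_right)
  then show ?thesis
    unfolding hermite_span_def by (intro range_eqI)
qed

lemma hermite_span_cmult: "h \<in> hermite_span k \<Longrightarrow> (\<lambda>x. c * h x) \<in> hermite_span k"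
proof -
  assume "h \<in> hermite_span k"
  then obtain d where "h = (\<lambda>x. \<Sum>\<alpha>\<in>multi_indices k. d \<alpha> * He_multi \<alpha> x)"
    unfolding hermite_span_def by blast
  then have "(\<lambda>x. c * h x) = (\<lambda>x. \<Sum>\<alpha>\<in>multi_indices k. (c * d \<alpha>) * He_multi \<alpha> x)"
    by (simp add: sum_distrib_left mult_ac)
  then show ?thesis
    unfolding hermite_span_def by (intro range_eqI)
qed

lemma hermite_span_sum:
  "(\<And>i. i \<in> A \<Longrightarrow> h i \<in> hermite_span k) \<Longrightarrow> (\<lambda>x. \<Sum>i\<in>A. h i x) \<in> hermite_span k"
  by (induction A rule: infinite_finite_induct) (auto intro: hermite_span_zero hermite_span_add)

lemma He_multi_in_hermite_span:
  assumes "(\<Sum>i\<in>UNIV. \<alpha> i) = k"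
  shows "He_multi \<alpha> \<in> hermite_span k"
proof -
  have "He_multi \<alpha> x = (\<Sum>\<beta>\<in>multi_indices k. (if \<beta> = \<alpha> then 1 else 0) * He_multi \<beta> x)" for x
    using sum.delta'[OF finite_multi_indices[of k], of \<alpha> "\<lambda>\<beta>. He_multi \<beta> x"] assms
    by (simp add: multi_indices_def if_distrib[of "\<lambda>c. c * _"] eq_commute[of _ \<alpha>] cong: if_cong)
  then show ?thesis
    unfolding hermite_span_def by (intro range_eqI ext)
qed

text \<open>A class that contains the sign functions, their half sums and half differences, and the
  truncated sign. Boundedness gives integrability against every polynomial, so no general theory of
  square-integrable functions is called for.\<close>

definition unit_functions :: "(real ^ 'n \<Rightarrow> real) set" where
  "unit_functions = {f \<in> borel_measurable borel. \<forall>x. \<bar>f x\<bar> \<le> 1}"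

lemma unit_functions_borel: "f \<in> unit_functions \<Longrightarrow> f \<in> borel_measurable borel"
  by (simp add: unit_functions_def)

lemma integrable_unit_mult:
  assumes f: "f \<in> unit_functions" and h: "integrable std_gaussian h"
  shows "integrable std_gaussian (\<lambda>x. f x * h x)"
proof (rule Bochner_Integration.integrable_bound[OF h])
  show "(\<lambda>x. f x * h x) \<in> borel_measurable std_gaussian"
    using f h by (auto simp: unit_functions_def)
  show "AE x in std_gaussian. norm (f x * h x) \<le> norm (h x)"
    using f by (auto simp: unit_functions_def abs_mult mult_left_le_one_le)
qed

lemma hermite_span_integrable:
  assumes "h \<in> hermite_span k"
  shows "integrable std_gaussian h"
  using assms unfolding hermite_span_def
  by (auto intro!: Bochner_Integration.integrable_sum integrable_mult_right integrable_He_multi)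

lemma hermite_span_borel: "h \<in> hermite_span k \<Longrightarrow> h \<in> borel_measurable borel"
  by (metis borel_measurable_integrable hermite_span_integrable measurable_cong_sets sets_std_gaussian)

lemma hermite_span_integrable_mult:
  assumes "g \<in> hermite_span k" "h \<in> hermite_span l"
  shows "integrable std_gaussian (\<lambda>x. g x * h x)"
  using assms unfolding hermite_span_def
  by (auto simp: sum_product mult_ac intro!: Bochner_Integration.integrable_sum integrable_mult_right)
    (auto simp: mult.left_commute intro!: integrable_mult_right integrable_He_multi_mult)

section \<open>Existence, uniqueness and coefficients of the Hermite projections\<close>

lemma gauss_inner_span_He_multi:
  assumes "\<beta> \<in> multi_indices k"
  shows "gauss_inner (\<lambda>x. \<Sum>\<alpha>\<in>multi_indices k. c \<alpha> * He_multi \<alpha> x) (He_multi \<beta>) = c \<beta> * mfact \<beta>"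
proof -
  have "gauss_inner (\<lambda>x. \<Sum>\<alpha>\<in>multi_indices k. c \<alpha> * He_multi \<alpha> x) (He_multi \<beta>)
     = (\<Sum>\<alpha>\<in>multi_indices k. c \<alpha> * (\<integral>x. He_multi \<alpha> x * He_multi \<beta> x \<partial>std_gaussian))"
    unfolding gauss_inner_def sum_distrib_right mult.assoc
    by (subst Bochner_Integration.integral_sum) (auto intro!: integrable_mult_right integrable_He_multi_mult)
  also have "\<dots> = (\<Sum>\<alpha>\<in>multi_indices k. if \<alpha> = \<beta> then c \<beta> * mfact \<beta> else 0)"
    by (intro sum.cong refl) (simp add: has_bochner_integral_integral_eq[OF has_bochner_integral_He_multi])
  finally show ?thesis
    using assms by (simp add: sum.delta finite_multi_indices)
qed

text \<open>Uniqueness behind the definite description: two candidates have equal inner products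
  with each \<open>He_multi \<alpha>\<close>, hence equal coefficients.\<close>

lemma hermite_proj_eqI:
  assumes f: "f \<in> unit_functions" and h: "h \<in> hermite_span k"
    and orth: "\<And>p. p \<in> hermite_span k \<Longrightarrow> gauss_inner (\<lambda>x. f x - h x) p = 0"
  shows "hermite_proj k f = h"
  unfolding hermite_proj_def
proof (rule the_equality)
  fix g assume g: "g \<in> hermite_span k \<and> (\<forall>p\<in>hermite_span k. gauss_inner (\<lambda>x. f x - g x) p = 0)"
  have inner: "gauss_inner q p = gauss_inner f p"
    if q: "q \<in> hermite_span k" and p: "p \<in> hermite_span k" and "gauss_inner (\<lambda>x. f x - q x) p = 0" for q p
  proof -
    have "integrable std_gaussian (\<lambda>x. f x * p x)"
      using integrable_unit_mult[OF f] hermite_span_integrable[OF p] by simp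
    then show ?thesis
      using that(3) hermite_span_integrable_mult[OF q p]
      by (simp add: gauss_inner_def left_diff_distrib)
  qed
  obtain c d where cd: "g = (\<lambda>x. \<Sum>\<alpha>\<in>multi_indices k. c \<alpha> * He_multi \<alpha> x)"
     "h = (\<lambda>x. \<Sum>\<alpha>\<in>multi_indices k. d \<alpha> * He_multi \<alpha> x)"
    using g h unfolding hermite_span_def by blast
  have "c \<alpha> = d \<alpha>" if \<alpha>: "\<alpha> \<in> multi_indices k" for \<alpha>
  proof -
    have He: "He_multi \<alpha> \<in> hermite_span k"
      using \<alpha> by (intro He_multi_in_hermite_span) (simp add: multi_indices_def)
    have "gauss_inner g (He_multi \<alpha>) = gauss_inner h (He_multi \<alpha>)"
      using inner[of g "He_multi \<alpha>"] inner[of h "He_multi \<alpha>"] g h orth He by simp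
    then have "c \<alpha> * mfact \<alpha> = d \<alpha> * mfact \<alpha>"
      unfolding cd gauss_inner_span_He_multi[OF \<alpha>] .
    then show ?thesis
      using mfact_pos[of \<alpha>] by simp
  qed
  then show "g = h"
    unfolding cd by simp
qed (use h orth in blast)

text \<open>Not normalized: the squared norm \<open>mfact \<alpha>\<close> is divided out wherever
  the coefficient enters an expansion.\<close>

definition hermite_coeff :: "(real ^ 'n \<Rightarrow> real) \<Rightarrow> ('n \<Rightarrow> nat) \<Rightarrow> real" where
  "hermite_coeff f \<alpha> = gauss_inner f (He_multi \<alpha>)"

text \<open>The Hermite expansion provides the existence half; orthogonality of the remainder needs
  checking only against the basis polynomials.\<close>

lemma hermite_proj_eq:
  assumes f: "f \<in> unit_functions"
  shows "hermite_proj k f = (\<lambda>x. \<Sum>\<alpha>\<in>multi_indices k. hermite_coeff f \<alpha> / mfact \<alpha> * He_multi \<alpha> x)"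
    (is "_ = ?h")
proof (rule hermite_proj_eqI[OF f])
  show h: "?h \<in> hermite_span k"
    unfolding hermite_span_def by (intro range_eqI) (rule refl)
  fix p :: "real ^ 'a \<Rightarrow> real" assume "p \<in> hermite_span k"
  then obtain c where p: "p = (\<lambda>x. \<Sum>\<alpha>\<in>multi_indices k. c \<alpha> * He_multi \<alpha> x)"
    unfolding hermite_span_def by blast
  have 0: "gauss_inner (\<lambda>x. f x - ?h x) (He_multi \<alpha>) = 0"
    and i: "integrable std_gaussian (\<lambda>x. (f x - ?h x) * He_multi \<alpha> x)" if \<alpha>: "\<alpha> \<in> multi_indices k" for \<alpha>
  proof -
    have He: "He_multi \<alpha> \<in> hermite_span k"
      using \<alpha> by (intro He_multi_in_hermite_span) (simp add: multi_indices_def)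
    have 1: "integrable std_gaussian (\<lambda>x. f x * He_multi \<alpha> x)"
      by (rule integrable_unit_mult[OF f integrable_He_multi])
    have 2: "integrable std_gaussian (\<lambda>x. ?h x * He_multi \<alpha> x)"
      by (rule hermite_span_integrable_mult[OF h He])
    show "integrable std_gaussian (\<lambda>x. (f x - ?h x) * He_multi \<alpha> x)"
      unfolding left_diff_distrib using 1 2 by (rule Bochner_Integration.integrable_diff)
    have "gauss_inner (\<lambda>x. f x - ?h x) (He_multi \<alpha>) = gauss_inner f (He_multi \<alpha>) - gauss_inner ?h (He_multi \<alpha>)"
      unfolding gauss_inner_def left_diff_distrib using 1 2 by (rule Bochner_Integration.integral_diff)
    then show "gauss_inner (\<lambda>x. f x - ?h x) (He_multi \<alpha>) = 0"
      unfolding gauss_inner_span_He_multi[OF \<alpha>] using mfact_pos[of \<alpha>] by (simp add: hermite_coeff_def)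
  qed
  have "gauss_inner (\<lambda>x. f x - ?h x) p
     = (\<Sum>\<alpha>\<in>multi_indices k. c \<alpha> * gauss_inner (\<lambda>x. f x - ?h x) (He_multi \<alpha>))"
    unfolding gauss_inner_def p sum_distrib_left mult.left_commute[of _ "c _"]
    using i by (subst Bochner_Integration.integral_sum) auto
  then show "gauss_inner (\<lambda>x. f x - ?h x) p = 0"
    using 0 by simp
qed

lemma hermite_proj_in_span: "f \<in> unit_functions \<Longrightarrow> hermite_proj k f \<in> hermite_span k"
  unfolding hermite_proj_eq hermite_span_def by (intro range_eqI) (rule refl)

lemma gauss_inner_hermite_proj_span:
  assumes f: "f \<in> unit_functions" and p: "p \<in> hermite_span k"
  shows "gauss_inner (hermite_proj k f) p = gauss_inner f p"
proof -
  obtain c where c: "p = (\<lambda>x. \<Sum>\<alpha>\<in>multi_indices k. c \<alpha> * He_multi \<alpha> x)"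
    using p unfolding hermite_span_def by blast
  have sum: "gauss_inner q p = (\<Sum>\<alpha>\<in>multi_indices k. c \<alpha> * gauss_inner q (He_multi \<alpha>))"
    if "\<And>\<alpha>. integrable std_gaussian (\<lambda>x. q x * He_multi \<alpha> x)" for q
    unfolding c gauss_inner_def sum_distrib_left mult.left_commute[of _ "c _"]
    using that by (subst Bochner_Integration.integral_sum) auto
  have "gauss_inner (hermite_proj k f) (He_multi \<alpha>) = gauss_inner f (He_multi \<alpha>)" if "\<alpha> \<in> multi_indices k" for \<alpha>
    unfolding hermite_proj_eq[OF f] gauss_inner_span_He_multi[OF that]
    using mfact_pos[of \<alpha>] by (simp add: hermite_coeff_def)
  then show ?thesis
    by (simp add: sum hermite_span_integrable_mult[OF hermite_proj_in_span[OF f] He_multi_in_hermite_span[OF refl]]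
        integrable_unit_mult[OF f integrable_He_multi])
qed

text \<open>The bilinear form of the degree-\<open>k\<close> projection, written through
  coefficients so that symmetry and positivity are evident.\<close>

definition level :: "nat \<Rightarrow> (real ^ 'n \<Rightarrow> real) \<Rightarrow> (real ^ 'n \<Rightarrow> real) \<Rightarrow> real" where
  "level k f g = (\<Sum>\<alpha>\<in>multi_indices k. hermite_coeff f \<alpha> * hermite_coeff g \<alpha> / mfact \<alpha>)"

lemma gauss_inner_hermite_proj:
  assumes f: "f \<in> unit_functions" and g: "g \<in> unit_functions"
  shows "gauss_inner (hermite_proj k f) g = level k f g"
proof -
  have i: "integrable std_gaussian (\<lambda>x. g x * He_multi \<alpha> x)" for \<alpha>
    by (rule integrable_unit_mult[OF g integrable_He_multi])
  have "gauss_inner (hermite_proj k f) g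
     = (\<integral>x. (\<Sum>\<alpha>\<in>multi_indices k. hermite_coeff f \<alpha> / mfact \<alpha> * (g x * He_multi \<alpha> x)) \<partial>std_gaussian)"
    unfolding gauss_inner_def hermite_proj_eq[OF f] by (simp add: sum_distrib_left sum_distrib_right mult_ac)
  also have "\<dots> = level k f g"
    using i by (subst Bochner_Integration.integral_sum) (auto simp: level_def hermite_coeff_def gauss_inner_def)
  finally show ?thesis .
qed

section \<open>Rotation invariance\<close>

text \<open>The creation operator in one variable: the lower-order term of the recursion is exactly
  the derivative.\<close>

lemma He_Suc: "He (Suc k) = [:0, 1:] * He k - pderiv (He k)"
  using pderiv_He[of "k - 1"] by (cases k) (simp_all add: pderiv_1)

text \<open>
  \<open>raises u h h'\<close> says that the creation operator \<open>h \<mapsto> \<langle>u, x\<rangle> h - \<partial>\<^sub>u h\<close> maps \<open>h\<close> to \<open>h'\<close>.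
  These operators generate the Hermite spaces from the constants, and a rotation merely permutes them.
\<close>

definition raises :: "real ^ 'n \<Rightarrow> (real ^ 'n \<Rightarrow> real) \<Rightarrow> (real ^ 'n \<Rightarrow> real) \<Rightarrow> bool" where
  "raises u h h' \<longleftrightarrow> (\<forall>x. ((\<lambda>t. h (x + t *\<^sub>R u)) has_real_derivative (u \<bullet> x) * h x - h' x) (at 0))"

lemma raises_unique:
  assumes "raises u h h'" "raises u h h''"
  shows "h' = h''"
proof
  fix x
  show "h' x = h'' x"
    using DERIV_unique[of "\<lambda>t. h (x + t *\<^sub>R u)" _ 0] assms unfolding raises_def by fastforce
qed

lemma raises_sum:
  assumes "\<And>i. i \<in> A \<Longrightarrow> raises u (h i) (h' i)"
  shows "raises u (\<lambda>x. \<Sum>i\<in>A. c i * h i x) (\<lambda>x. \<Sum>i\<in>A. c i * h' i x)"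
  unfolding raises_def
proof
  fix x
  have "((\<lambda>t. \<Sum>i\<in>A. c i * h i (x + t *\<^sub>R u)) has_real_derivative (\<Sum>i\<in>A. c i * ((u \<bullet> x) * h i x - h' i x))) (at 0)"
    using assms by (intro DERIV_sum DERIV_cmult) (auto simp: raises_def)
  then show "((\<lambda>t. \<Sum>i\<in>A. c i * h i (x + t *\<^sub>R u)) has_real_derivative
      (u \<bullet> x) * (\<Sum>i\<in>A. c i * h i x) - (\<Sum>i\<in>A. c i * h' i x)) (at 0)"
    by (simp add: sum_distrib_left right_diff_distrib sum_subtractf mult.left_commute)
qed

text \<open>By the product rule the derivative along \<open>u\<close> splits over the coordinates,
  and \<open>He_Suc\<close> turns each summand into a raised Hermite factor.\<close>

lemma raises_He_multi:
  "raises u (He_multi \<alpha>) (\<lambda>x. \<Sum>i\<in>UNIV. u $ i * He_multi (\<alpha>(i := Suc (\<alpha> i))) x)"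
  unfolding raises_def
proof
  fix x
  let ?P = "\<lambda>i. \<Prod>j\<in>UNIV - {i}. poly (He (\<alpha> j)) (x $ j)"
  have "((\<lambda>t. poly (He (\<alpha> i)) ((x + t *\<^sub>R u) $ i)) has_real_derivative
      poly (pderiv (He (\<alpha> i))) (x $ i) * u $ i) (at 0)" for i
    by (auto intro!: derivative_eq_intros DERIV_chain2[OF poly_DERIV])
  from has_field_derivative_prod[OF this]
  have "((\<lambda>t. He_multi \<alpha> (x + t *\<^sub>R u)) has_real_derivative
      (\<Sum>i\<in>UNIV. poly (pderiv (He (\<alpha> i))) (x $ i) * u $ i * ?P i)) (at 0)"
    unfolding He_multi_def by simp
  moreover have "(\<Sum>i\<in>UNIV. poly (pderiv (He (\<alpha> i))) (x $ i) * u $ i * ?P i)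
      = (u \<bullet> x) * He_multi \<alpha> x - (\<Sum>i\<in>UNIV. u $ i * He_multi (\<alpha>(i := Suc (\<alpha> i))) x)"
  proof -
    have 1: "He_multi \<alpha> x = poly (He (\<alpha> i)) (x $ i) * ?P i" for i
      unfolding He_multi_def by (rule prod.remove) auto
    have 2: "He_multi (\<alpha>(i := Suc (\<alpha> i))) x = poly (He (Suc (\<alpha> i))) (x $ i) * ?P i" for i
    proof -
      have "He_multi (\<alpha>(i := Suc (\<alpha> i))) x = poly (He (Suc (\<alpha> i))) (x $ i) *
         (\<Prod>j\<in>UNIV - {i}. poly (He ((\<alpha>(i := Suc (\<alpha> i))) j)) (x $ j))"
        unfolding He_multi_def by (subst prod.remove[of _ i]) auto
      also have "(\<Prod>j\<in>UNIV - {i}. poly (He ((\<alpha>(i := Suc (\<alpha> i))) j)) (x $ j)) = ?P i"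
        by (intro prod.cong) auto
      finally show ?thesis .
    qed
    have "(u \<bullet> x) * He_multi \<alpha> x = (\<Sum>i\<in>UNIV. u $ i * x $ i * (poly (He (\<alpha> i)) (x $ i) * ?P i))"
      by (simp add: inner_vec_def sum_distrib_right flip: 1)
    then show ?thesis
      by (simp add: 2 He_Suc left_diff_distrib right_diff_distrib sum_subtractf mult_ac)
  qed
  ultimately show "((\<lambda>t. He_multi \<alpha> (x + t *\<^sub>R u)) has_real_derivative
      (u \<bullet> x) * He_multi \<alpha> x - (\<Sum>i\<in>UNIV. u $ i * He_multi (\<alpha>(i := Suc (\<alpha> i))) x)) (at 0)"
    by simp
qed

lemma sum_fun_upd_Suc: "(\<Sum>j\<in>UNIV. (\<alpha>(i := Suc (\<alpha> i))) j) = Suc (\<Sum>j\<in>UNIV. \<alpha> j)" for \<alpha> :: "'n::finite \<Rightarrow> nat"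
proof -
  have "(\<Sum>j\<in>UNIV. (\<alpha>(i := Suc (\<alpha> i))) j) = (\<Sum>j\<in>UNIV. \<alpha> j + (if i = j then 1 else 0))"
    by (intro sum.cong) auto
  then show ?thesis
    by (simp add: sum.distrib)
qed

lemma hermite_span_raises:
  assumes "h \<in> hermite_span k"
  obtains h' where "h' \<in> hermite_span (Suc k)" "raises u h h'"
proof -
  obtain c where h: "h = (\<lambda>x. \<Sum>\<alpha>\<in>multi_indices k. c \<alpha> * He_multi \<alpha> x)"
    using assms unfolding hermite_span_def by blast
  let ?h' = "\<lambda>x. \<Sum>\<alpha>\<in>multi_indices k. c \<alpha> * (\<Sum>i\<in>UNIV. u $ i * He_multi (\<alpha>(i := Suc (\<alpha> i))) x)"
  have "raises u h ?h'"
    unfolding h by (intro raises_sum raises_He_multi)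
  moreover have "?h' \<in> hermite_span (Suc k)"
    by (intro hermite_span_sum hermite_span_cmult He_multi_in_hermite_span)
      (auto simp: multi_indices_def sum_fun_upd_Suc simp del: fun_upd_apply)
  ultimately show thesis using that by blast
qed

text \<open>By linearity \<open>R\<close> maps lines in direction \<open>u\<close> to lines in
  direction \<open>R u\<close>, and it preserves the inner product in the multiplication
  term.\<close>

lemma raises_orthogonal:
  assumes R: "orthogonal_transformation R" and h: "raises (R u) h h'"
  shows "raises u (h \<circ> R) (h' \<circ> R)"
proof -
  have "R (x + t *\<^sub>R u) = R x + t *\<^sub>R R u" for x t
    using orthogonal_transformation_linear[OF R] by (simp add: linear_add linear_scale)
  moreover have "u \<bullet> x = R u \<bullet> R x" for x
    using R by (simp add: orthogonal_transformation_def)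
  ultimately show ?thesis
    using h by (simp add: raises_def)
qed

text \<open>Induction on the degree: \<open>He_multi \<alpha>\<close> arises from some
  \<open>He_multi \<beta>\<close> of lower degree by raising along an axis, and raising commutes
  with \<open>R\<close> once the direction is pulled back. Since the raised function is unique, it
  is the one already known to lie in the span.\<close>

lemma hermite_span_orthogonal:
  fixes R :: "real ^ 'n \<Rightarrow> real ^ 'n"
  assumes R: "orthogonal_transformation R" and h: "h \<in> hermite_span k"
  shows "h \<circ> R \<in> hermite_span k"
proof -
  have "He_multi \<alpha> \<circ> R \<in> hermite_span k" if "(\<Sum>i\<in>UNIV. \<alpha> i) = k" for \<alpha>
    using that
  proof (induction k arbitrary: \<alpha>)
    case 0
    then have "He_multi \<alpha> \<circ> R = He_multi \<alpha>"
      by (auto simp: He_multi_def)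
    then show ?case
      using 0 He_multi_in_hermite_span by metis
  next
    case (Suc k)
    obtain i where "\<alpha> i \<noteq> 0"
      using Suc.prems by (metis sum.neutral nat.distinct(1))
    define \<beta> where "\<beta> = \<alpha>(i := \<alpha> i - 1)"
    have \<alpha>: "\<alpha> = \<beta>(i := Suc (\<beta> i))"
      using \<open>\<alpha> i \<noteq> 0\<close> by (auto simp: \<beta>_def)
    have "(\<Sum>i\<in>UNIV. \<beta> i) = k"
      using Suc.prems sum_fun_upd_Suc[of \<beta> i] unfolding \<alpha> by simp
    then have "He_multi \<beta> \<circ> R \<in> hermite_span k"
      by (rule Suc.IH)
    have "axis i 1 \<in> range R"
      using orthogonal_transformation_surj[OF R] by simp
    then obtain u where u: "R u = axis i 1"
      by force
    obtain h where h: "h \<in> hermite_span (Suc k)" "raises u (He_multi \<beta> \<circ> R) h"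
      using hermite_span_raises[OF \<open>He_multi \<beta> \<circ> R \<in> hermite_span k\<close>] by blast
    have "raises (R u) (He_multi \<beta>) (He_multi \<alpha>)"
      using raises_He_multi[of "R u" \<beta>] by (simp add: u \<alpha> axis_def if_distrib[of "\<lambda>c. c * _"] cong: if_cong)
    then have "raises u (He_multi \<beta> \<circ> R) (He_multi \<alpha> \<circ> R)"
      by (rule raises_orthogonal[OF R])
    then show ?case
      using raises_unique[OF h(2)] h(1) by metis
  qed
  note * = this
  obtain c where c: "h = (\<lambda>x. \<Sum>\<alpha>\<in>multi_indices k. c \<alpha> * He_multi \<alpha> x)"
    using h unfolding hermite_span_def by blast
  have "(\<lambda>x. \<Sum>\<alpha>\<in>multi_indices k. c \<alpha> * (He_multi \<alpha> \<circ> R) x) \<in> hermite_span k"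
    by (rule hermite_span_sum, rule hermite_span_cmult, rule *) (simp add: multi_indices_def)
  then show ?thesis
    by (simp add: c o_def)
qed

lemma unit_functions_orthogonal:
  fixes R :: "real ^ 'n \<Rightarrow> real ^ 'n"
  assumes "orthogonal_transformation R" "f \<in> unit_functions"
  shows "f \<circ> R \<in> unit_functions"
  using assms borel_measurable_orthogonal[of R] by (auto simp: unit_functions_def intro!: measurable_comp)

lemma gauss_inner_orthogonal:
  fixes R :: "real ^ 'n \<Rightarrow> real ^ 'n"
  assumes R: "orthogonal_transformation R" and "f \<in> borel_measurable borel" "g \<in> borel_measurable borel"
  shows "gauss_inner (f \<circ> R) (g \<circ> R) = gauss_inner f g"
  using assms(2,3) integral_std_gaussian_orthogonal[OF R, of "\<lambda>x. f x * g x"] by (simp add: gauss_inner_def)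

text \<open>Both the span and the inner product are invariant, so orthogonality to \<open>p\<close>
  after the rotation is orthogonality to \<open>p \<circ> Q\<close> before it, with \<open>Q\<close>
  inverse to \<open>R\<close>.\<close>

lemma hermite_proj_orthogonal:
  fixes R :: "real ^ 'n \<Rightarrow> real ^ 'n"
  assumes R: "orthogonal_transformation R" and f: "f \<in> unit_functions"
  shows "hermite_proj k (f \<circ> R) = hermite_proj k f \<circ> R"
proof (rule hermite_proj_eqI)
  show "f \<circ> R \<in> unit_functions"
    by (rule unit_functions_orthogonal[OF R f])
  let ?h = "hermite_proj k f"
  have h: "?h \<in> hermite_span k"
    by (rule hermite_proj_in_span[OF f])
  show "?h \<circ> R \<in> hermite_span k"
    by (rule hermite_span_orthogonal[OF R h])
  fix p :: "real ^ 'n \<Rightarrow> real" assume p: "p \<in> hermite_span k"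
  obtain Q where Q: "orthogonal_transformation Q" "\<And>x. Q (R x) = x"
    using orthogonal_transformation_inv[OF R] orthogonal_transformation_inj[OF R] by (metis inv_f_f)
  have pQ: "p \<circ> Q \<in> hermite_span k"
    by (rule hermite_span_orthogonal[OF Q(1) p])
  have "gauss_inner (\<lambda>x. (f \<circ> R) x - (?h \<circ> R) x) p = gauss_inner ((\<lambda>x. f x - ?h x) \<circ> R) ((p \<circ> Q) \<circ> R)"
    by (simp add: o_def Q)
  also have "\<dots> = gauss_inner (\<lambda>x. f x - ?h x) (p \<circ> Q)"
    using unit_functions_borel[OF f] hermite_span_borel[OF h] hermite_span_borel[OF pQ]
    by (intro gauss_inner_orthogonal[OF R]) auto
  also have "\<dots> = gauss_inner f (p \<circ> Q) - gauss_inner ?h (p \<circ> Q)"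
    unfolding gauss_inner_def left_diff_distrib
    by (intro Bochner_Integration.integral_diff integrable_unit_mult[OF f] hermite_span_integrable[OF pQ]
        hermite_span_integrable_mult[OF h pQ])
  also have "\<dots> = 0"
    by (simp add: gauss_inner_hermite_proj_span[OF f pQ])
  finally show "gauss_inner (\<lambda>x. (f \<circ> R) x - (?h \<circ> R) x) p = 0" .
qed

lemma level_orthogonal:
  fixes R :: "real ^ 'n \<Rightarrow> real ^ 'n"
  assumes R: "orthogonal_transformation R" and f: "f \<in> unit_functions" and g: "g \<in> unit_functions"
  shows "level k (f \<circ> R) (g \<circ> R) = level k f g"
proof -
  have "level k (f \<circ> R) (g \<circ> R) = gauss_inner (hermite_proj k f \<circ> R) (g \<circ> R)"
    using gauss_inner_hermite_proj[of "f \<circ> R" "g \<circ> R" k] unit_functions_orthogonal[OF R] f g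
    by (simp add: hermite_proj_orthogonal[OF R f])
  also have "\<dots> = gauss_inner (hermite_proj k f) g"
    by (intro gauss_inner_orthogonal[OF R] hermite_span_borel[OF hermite_proj_in_span[OF f]] unit_functions_borel[OF g])
  finally show ?thesis
    using gauss_inner_hermite_proj[OF f g] by simp
qed

section \<open>One-dimensional Gaussian integrals\<close>

text \<open>The sign function set to zero on the open strip of half-width \<open>c\<close>. For
  \<open>c = C_star\<close> it is the optimal half sum of \<open>f\<close> and \<open>g\<close>, as
  a function of one coordinate.\<close>

definition outer_sign :: "real \<Rightarrow> real \<Rightarrow> real" where
  "outer_sign c x = (if c \<le> x then 1 else if x \<le> - c then -1 else 0)"

lemma outer_sign_borel [measurable]: "outer_sign c \<in> borel_measurable borel"
  unfolding outer_sign_def by measurable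

lemma abs_outer_sign_le: "\<bar>outer_sign c x\<bar> \<le> 1"
  by (simp add: outer_sign_def)

lemma std_normal_density_minus: "std_normal_density (- x) = std_normal_density x"
  by (simp add: std_normal_density_def)

lemma has_bochner_integral_gauss1_reflect:
  fixes h :: "real \<Rightarrow> real"
  assumes "has_bochner_integral gauss1 h I"
  shows "has_bochner_integral gauss1 (\<lambda>x. h (- x)) I"
proof -
  have [measurable]: "h \<in> borel_measurable borel"
    using borel_measurable_has_bochner_integral[OF assms] by simp
  have *: "has_bochner_integral lborel (\<lambda>x. std_normal_density x * h x) I"
    using assms by (simp add: has_bochner_integral_iff integrable_gauss1_iff integral_gauss1)
  have "has_bochner_integral lborel (\<lambda>x. std_normal_density (- x) * h (- x)) I"
    using * lborel_has_bochner_integral_real_affine_iff[of "- 1" "\<lambda>x. std_normal_density x * h x" I 0] by simp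
  then show ?thesis
    by (simp add: has_bochner_integral_iff integrable_gauss1_iff integral_gauss1 std_normal_density_minus)
qed

text \<open>The fundamental theorem of calculus on a half-line for a nonnegative integrand, with an
  antiderivative normalized to vanish at infinity.\<close>

lemma has_bochner_integral_gauss1_tail:
  fixes f F :: "real \<Rightarrow> real"
  assumes [measurable]: "f \<in> borel_measurable borel"
    and deriv: "\<And>x. c \<le> x \<Longrightarrow> (F has_real_derivative std_normal_density x * f x) (at x)"
    and nonneg: "\<And>x. c \<le> x \<Longrightarrow> 0 \<le> f x"
    and lim: "(F \<longlongrightarrow> 0) at_top"
  shows "has_bochner_integral gauss1 (\<lambda>x. indicator {c..} x * f x) (- F c)"
proof -
  \<comment> \<open>The integral is computed in \<open>ennreal\<close>, which truncates negative
    reals, so the sign of its value has to be known first. It holds because \<open>F\<close>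
    increases to 0.\<close>
  have "0 \<le> - F c"
  proof (rule tendsto_lowerbound[where f = "\<lambda>x. F x - F c" and F = at_top])
    show "((\<lambda>x. F x - F c) \<longlongrightarrow> - F c) at_top"
      using tendsto_diff[OF lim tendsto_const[of "F c"]] by simp
    have "F c \<le> F x" if "c \<le> x" for x
      using that by (intro DERIV_nonneg_imp_nondecreasing[of c x F]) (auto intro!: exI deriv nonneg mult_nonneg_nonneg)
    then show "\<forall>\<^sub>F x in at_top. 0 \<le> F x - F c"
      by (intro eventually_mono[OF eventually_ge_at_top[of c]]) simp
  qed simp
  have *: "(\<integral>\<^sup>+x. ennreal (std_normal_density x * f x) * indicator {c..} x \<partial>lborel) = ennreal (0 - F c)"
    by (rule nn_integral_FTC_atLeast[OF _ deriv _ lim]) (auto intro!: mult_nonneg_nonneg nonneg)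
  have "has_bochner_integral lborel (\<lambda>x. std_normal_density x * f x * indicator {c..} x) (- F c)"
  proof (intro has_bochner_integral_nn_integral)
    have "(\<integral>\<^sup>+x. ennreal (std_normal_density x * f x * indicator {c..} x) \<partial>lborel)
        = (\<integral>\<^sup>+x. ennreal (std_normal_density x * f x) * indicator {c..} x \<partial>lborel)"
      by (intro nn_integral_cong) (auto simp: indicator_def)
    with * show "(\<integral>\<^sup>+x. ennreal (std_normal_density x * f x * indicator {c..} x) \<partial>lborel) = ennreal (- F c)"
      by simp
  qed (use \<open>0 \<le> - F c\<close> nonneg in \<open>auto simp: indicator_def\<close>)
  then show ?thesis
    by (simp add: has_bochner_integral_iff integrable_gauss1_iff integral_gauss1 mult_ac)
qed

section \<open>Moments of the truncated sign\<close>

lemma DERIV_std_normal_density: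
  "(std_normal_density has_real_derivative - x * std_normal_density x) (at x)"
proof -
  have "((\<lambda>x. 1 / sqrt (2 * pi) * exp (- x\<^sup>2 / 2)) has_real_derivative
      1 / sqrt (2 * pi) * (- x * exp (- x\<^sup>2 / 2))) (at x)"
    by (intro DERIV_cmult) (auto intro!: derivative_eq_intros simp: power2_eq_square)
  then show ?thesis
    unfolding std_normal_density_def by (simp add: mult_ac)
qed

lemma continuous_std_normal_density: "continuous_on A std_normal_density"
  using DERIV_std_normal_density by (meson DERIV_continuous continuous_at_imp_continuous_on)

lemma has_bochner_integral_tail_1:
  assumes "c > 0"
  shows "has_bochner_integral gauss1 (\<lambda>x. indicator {c..} x * x) (std_normal_density c)"
proof -
  have "has_bochner_integral gauss1 (\<lambda>x. indicator {c..} x * x) (- (- std_normal_density c))"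
  proof (rule has_bochner_integral_gauss1_tail)
    show "((\<lambda>x. - std_normal_density x) has_real_derivative std_normal_density x * x) (at x)" for x
      using DERIV_minus[OF DERIV_std_normal_density[of x]] by (simp add: mult.commute)
    show "((\<lambda>x. - std_normal_density x) \<longlongrightarrow> 0) at_top"
      unfolding std_normal_density_def by real_asymp
  qed (use assms in auto)
  then show ?thesis by simp
qed

lemma has_bochner_integral_tail_3:
  assumes "c > 0"
  shows "has_bochner_integral gauss1 (\<lambda>x. indicator {c..} x * x ^ 3) ((c\<^sup>2 + 2) * std_normal_density c)"
proof -
  have "has_bochner_integral gauss1 (\<lambda>x. indicator {c..} x * x ^ 3) (- (- ((c\<^sup>2 + 2) * std_normal_density c)))"
  proof (rule has_bochner_integral_gauss1_tail)
    show "((\<lambda>x. - ((x\<^sup>2 + 2) * std_normal_density x)) has_real_derivative std_normal_density x * x ^ 3) (at x)" for x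
      by (auto intro!: derivative_eq_intros DERIV_std_normal_density simp: power2_eq_square power3_eq_cube algebra_simps)
    show "((\<lambda>x. - ((x\<^sup>2 + 2) * std_normal_density x)) \<longlongrightarrow> 0) at_top"
      unfolding std_normal_density_def by real_asymp
  qed (use assms in auto)
  then show ?thesis by simp
qed

text \<open>The truncated sign is odd, so against an odd \<open>f\<close> the negative tail
  contributes as much as the positive one.\<close>

lemma has_bochner_integral_outer_sign_odd:
  fixes f :: "real \<Rightarrow> real"
  assumes c: "c > 0" and I: "has_bochner_integral gauss1 (\<lambda>x. indicator {c..} x * f x) I"
    and odd: "\<And>x. f (- x) = - f x"
  shows "has_bochner_integral gauss1 (\<lambda>x. outer_sign c x * f x) (2 * I)"
proof -
  have "has_bochner_integral gauss1 (\<lambda>x. indicator {c..} x * f x + indicator {c..} (- x) * f (- x)) (I + I)"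
    using I has_bochner_integral_gauss1_reflect[OF I] by (rule has_bochner_integral_add)
  moreover have "indicator {c..} x * f x + indicator {c..} (- x) * f (- x) = outer_sign c x * f x" for x
    using c by (auto simp: outer_sign_def odd indicator_def)
  ultimately show ?thesis by simp
qed

lemma outer_sign_moment_1:
  assumes "c > 0"
  shows "has_bochner_integral gauss1 (\<lambda>x. outer_sign c x * x) (2 * std_normal_density c)"
  using has_bochner_integral_outer_sign_odd[OF assms has_bochner_integral_tail_1[OF assms]] by simp

lemma outer_sign_He_3:
  assumes "c > 0"
  shows "has_bochner_integral gauss1 (\<lambda>x. outer_sign c x * poly (He 3) x) (- 2 * (1 - c\<^sup>2) * std_normal_density c)"
proof -
  have He3: "poly (He 3) x = x ^ 3 - 3 * x" for x
    by (simp add: numeral_3_eq_3 power3_eq_cube algebra_simps)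
  have "has_bochner_integral gauss1 (\<lambda>x. outer_sign c x * x ^ 3 - 3 * (outer_sign c x * x))
      (2 * ((c\<^sup>2 + 2) * std_normal_density c) - 3 * (2 * std_normal_density c))"
    by (intro has_bochner_integral_diff has_bochner_integral_mult_right outer_sign_moment_1[OF assms]
      has_bochner_integral_outer_sign_odd[OF assms has_bochner_integral_tail_3[OF assms]]) simp
  then show ?thesis
    by (simp add: He3 algebra_simps)
qed

lemma has_bochner_integral_tail_0:
  "has_bochner_integral gauss1 (indicator {c..}) (Phi (- c))"
proof -
  interpret prob_space gauss1 by (rule prob_space_gauss1)
  have 1: "integrable gauss1 (indicator {..- c} :: real \<Rightarrow> real)"
    by (simp add: less_top[symmetric])
  then have "integral\<^sup>L gauss1 (indicator {..- c}) = Phi (- c)"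
    unfolding Phi_def set_lebesgue_integral_def by (subst integral_gauss1) (auto simp: mult.commute)
  then have "has_bochner_integral gauss1 (indicator {..- c}) (Phi (- c))"
    using 1 by (simp add: has_bochner_integral_iff)
  from has_bochner_integral_gauss1_reflect[OF this]
  have "has_bochner_integral gauss1 (\<lambda>x. indicator {..- c} (- x)) (Phi (- c))" .
  moreover have "(\<lambda>x. indicator {..- c} (- x)) = (indicator {c..} :: real \<Rightarrow> real)"
    by (auto simp: indicator_def)
  ultimately show ?thesis by simp
qed

lemma abs_outer_sign_moment_0:
  assumes "c > 0"
  shows "has_bochner_integral gauss1 (\<lambda>x. \<bar>outer_sign c x\<bar>) (2 * Phi (- c))"
proof -
  have "has_bochner_integral gauss1 (\<lambda>x. indicator {c..} x + indicator {c..} (- x)) (Phi (- c) + Phi (- c))"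
    using has_bochner_integral_tail_0 has_bochner_integral_gauss1_reflect[OF has_bochner_integral_tail_0]
    by (rule has_bochner_integral_add)
  moreover have "indicator {c..} x + indicator {c..} (- x) = \<bar>outer_sign c x\<bar>" for x
    using assms by (auto simp: outer_sign_def indicator_def)
  ultimately show ?thesis by simp
qed

section \<open>Density bounds and the mass of half-lines\<close>

lemma std_normal_density_le: "std_normal_density x \<le> 0.4"
proof -
  have "1 / sqrt (2 * pi) \<le> 0.4"
    using pi_approx real_le_rsqrt[of "2.5" "2 * pi"] by (simp add: power2_eq_square divide_simps)
  moreover have "exp (- x\<^sup>2 / 2) \<le> 1" by simp
  ultimately show ?thesis
    unfolding std_normal_density_def using mult_mono[of "1 / sqrt (2 * pi)" "0.4" "exp (- x\<^sup>2 / 2)" 1] by simp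
qed

text \<open>The set is covered by two intervals of length \<open>2 * \<eta>\<close>, and the density
  is at most 0.4.\<close>

lemma gauss1_near_le:
  assumes "\<eta> \<ge> 0"
  shows "(\<integral>x. indicator {x. \<bar>\<bar>x\<bar> - c\<bar> < \<eta>} x \<partial>gauss1) \<le> 1.6 * \<eta>"
proof -
  let ?A = "{c - \<eta>..c + \<eta>} :: real set" and ?B = "{- c - \<eta>..- c + \<eta>} :: real set"
  have i: "integrable lborel (\<lambda>x. 0.4 * (indicator ?A x + indicator ?B x) :: real)"
    by (intro integrable_mult_right Bochner_Integration.integrable_add)
      (auto intro!: integrable_real_indicator simp: emeasure_lborel_Icc_eq)
  have "(\<integral>x. indicator {x. \<bar>\<bar>x\<bar> - c\<bar> < \<eta>} x \<partial>gauss1)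
     = (\<integral>x. std_normal_density x * indicator {x. \<bar>\<bar>x\<bar> - c\<bar> < \<eta>} x \<partial>lborel)"
    by (rule integral_gauss1) measurable
  also have "\<dots> \<le> (\<integral>x. 0.4 * (indicator ?A x + indicator ?B x) \<partial>lborel)"
  proof (rule integral_mono[OF _ i])
    show le: "std_normal_density x * indicator {x. \<bar>\<bar>x\<bar> - c\<bar> < \<eta>} x \<le> 0.4 * (indicator ?A x + indicator ?B x)" for x
      using std_normal_density_le[of x] by (auto simp: indicator_def)
    show "integrable lborel (\<lambda>x. std_normal_density x * indicator {x. \<bar>\<bar>x\<bar> - c\<bar> < \<eta>} x :: real)"
      by (rule Bochner_Integration.integrable_bound[OF i]) (use le in \<open>auto simp: abs_mult\<close>)
  qed
  also have "\<dots> = 1.6 * \<eta>"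
    using assms by simp
  finally show ?thesis .
qed

text \<open>Symmetry gives \<open>Phi 0 = 1 / 2\<close>. The compact integral is what can be
  differentiated and estimated numerically.\<close>

lemma half_line_Phi:
  assumes "0 \<le> c"
  shows "Phi (- c) = 1 / 2 - integral {0..c} std_normal_density"
proof -
  interpret prob_space gauss1 by (rule prob_space_gauss1)
  have total: "has_bochner_integral gauss1 (\<lambda>x. indicator {c..} x + indicator {0..<c} x) (Phi (- c) + integral {0..c} std_normal_density)"
    if "0 \<le> c" for c
  proof (intro has_bochner_integral_add has_bochner_integral_tail_0)
    have si: "set_integrable lborel {0..c} std_normal_density"
      by (intro borel_integrable_atLeastAtMost' continuous_std_normal_density)
    have ae: "AE x in lborel. std_normal_density x * indicator {0..<c} x = indicator {0..c} x * std_normal_density x"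
      using AE_lborel_singleton[of c] by eventually_elim (auto simp: indicator_def)
    have "(\<integral>x. indicator {0..<c} x \<partial>gauss1) = (LINT x:{0..c}|lborel. std_normal_density x)"
      unfolding set_lebesgue_integral_def
      by (subst integral_gauss1) (use ae in \<open>auto intro!: integral_cong_AE\<close>)
    also have "\<dots> = integral {0..c} std_normal_density"
      by (rule set_borel_integral_eq_integral[OF si])
    finally show "has_bochner_integral gauss1 (indicator {0..<c}) (integral {0..c} std_normal_density)"
      by (auto simp: has_bochner_integral_iff less_top[symmetric])
  qed
  have "has_bochner_integral gauss1 (\<lambda>x. indicator {0..} x + indicator {0..} (- x)) (Phi (- 0) + Phi (- 0))"
    using has_bochner_integral_tail_0 has_bochner_integral_gauss1_reflect[OF has_bochner_integral_tail_0]
    by (rule has_bochner_integral_add)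
  moreover have "AE x in gauss1. indicator {0..} x + indicator {0..} (- x) = (1 :: real)"
    using AE_lborel_singleton[of "0::real"] by (subst AE_density) (auto simp: indicator_def elim: eventually_mono)
  ultimately have "has_bochner_integral gauss1 (\<lambda>x. 1) (Phi 0 + Phi 0)"
    by (subst (asm) has_bochner_integral_cong_AE[where g = "\<lambda>x. 1"]) auto
  then have "Phi 0 = 1 / 2"
    using prob_space by (simp add: has_bochner_integral_iff)
  moreover have "(\<lambda>x. indicator {c..} x + indicator {0..<c} x) = (indicator {0..} :: real \<Rightarrow> real)"
    using assms by (auto simp: indicator_def)
  ultimately show ?thesis
    using total[OF assms] has_bochner_integral_tail_0[of 0] has_bochner_integral_eq by force
qed

section \<open>The critical strip\<close>

abbreviation crit :: "real \<Rightarrow> real" where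
  "crit C \<equiv> 4 * (std_normal_density C)\<^sup>2 - 4 * Phi (- C) + 1"

lemma std_normal_density_pos: "0 < std_normal_density x"
  by (simp add: std_normal_density_def)

lemma std_normal_density_sq: "(std_normal_density x)\<^sup>2 = exp (- x\<^sup>2) / (2 * pi)"
proof -
  have "(exp (- x\<^sup>2 / 2))\<^sup>2 = exp (- x\<^sup>2)"
    by (simp flip: exp_double)
  then show ?thesis
    by (simp add: std_normal_density_def power_mult_distrib power_divide)
qed

text \<open>The exponent is \<open>- 0.256\<^sup>2\<close>. The bound
  \<open>1 + x \<le> exp x\<close> is applied at 1/64 of it and squared six times, rounding
  down.\<close>

lemma exp_minus_bound: "0.93652 \<le> exp (- 0.065536 :: real)"
proof -
  have sq: "d \<le> exp (2 * x)" if "c \<le> exp x" "0 \<le> c" "d \<le> c * c" for c d x :: real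
    using mult_mono[OF that(1,1)] that unfolding exp_double power2_eq_square by simp
  have "0.998976 \<le> exp (- 0.001024 :: real)"
    using exp_ge_add_one_self[of "- 0.001024"] by simp
  from sq[OF this, of "0.997953"] have "0.997953 \<le> exp (- 0.002048 :: real)" by simp
  from sq[OF this, of "0.9959101"] have "0.9959101 \<le> exp (- 0.004096 :: real)" by simp
  from sq[OF this, of "0.9918369"] have "0.9918369 \<le> exp (- 0.008192 :: real)" by simp
  from sq[OF this, of "0.9837404"] have "0.9837404 \<le> exp (- 0.016384 :: real)" by simp
  from sq[OF this, of "0.9677451"] have "0.9677451 \<le> exp (- 0.032768 :: real)" by simp
  from sq[OF this, of "0.93652"] show ?thesis by simp
qed

lemma integral_std_normal_density_ge:
  assumes "0 \<le> c"
  shows "(c - c ^ 3 / 6) / sqrt (2 * pi) \<le> integral {0..c} std_normal_density"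
proof -
  have "((\<lambda>x. 1 - x\<^sup>2 / 2) has_integral (c - c ^ 3 / 6) - (0 - 0 ^ 3 / 6)) {0..c}"
    using assms by (intro fundamental_theorem_of_calculus)
      (auto intro!: derivative_eq_intros simp flip: has_real_derivative_iff_has_vector_derivative)
  then have "((\<lambda>x. (1 - x\<^sup>2 / 2) / sqrt (2 * pi)) has_integral (c - c ^ 3 / 6) / sqrt (2 * pi)) {0..c}"
    by (intro has_integral_divide) simp
  moreover have "(std_normal_density has_integral integral {0..c} std_normal_density) {0..c}"
    by (intro integrable_integral integrable_continuous_real continuous_std_normal_density)
  moreover have "(1 - x\<^sup>2 / 2) / sqrt (2 * pi) \<le> std_normal_density x" for x
    using exp_ge_add_one_self[of "- x\<^sup>2 / 2"] by (simp add: std_normal_density_def divide_right_mono)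
  ultimately show ?thesis
    by (auto dest: has_integral_le)
qed

text \<open>The point 0.256 lies just above \<open>C_star\<close>. The bounds 0.14905 and 0.101
  leave a margin of only \<open>4 * 0.14905 + 4 * 0.101 - 1 = 0.0002\<close>.\<close>

lemma crit_pos: "crit 0.256 > 0"
proof -
  have "0.93652 / (2 * 3.1416) \<le> exp (- 0.065536 :: real) / (2 * pi)"
    using exp_minus_bound pi_approx by (intro frac_le) auto
  then have 1: "0.14905 \<le> (std_normal_density 0.256)\<^sup>2"
    unfolding std_normal_density_sq by (simp add: power2_eq_square)
  have "sqrt (2 * pi) \<le> 2.50664"
    using pi_approx by (intro real_le_lsqrt) (auto simp: power2_eq_square)
  then have *: "0.2532 / 2.50664 \<le> (0.256 - 0.256 ^ 3 / 6) / sqrt (2 * pi)"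
    by (intro frac_le) (auto simp: power3_eq_cube)
  have "0.101 \<le> (0.2532 / 2.50664 :: real)"
    by simp
  also note *
  also have "(0.256 - 0.256 ^ 3 / 6) / sqrt (2 * pi) \<le> integral {0..0.256} std_normal_density"
    by (rule integral_std_normal_density_ge) simp
  finally have "0.101 \<le> integral {0..0.256} std_normal_density" .
  moreover have "Phi (- 0.256) = 1 / 2 - integral {0..0.256} std_normal_density"
    by (rule half_line_Phi) simp
  ultimately show ?thesis
    using 1 by simp
qed

text \<open>On \<open>[0, 1]\<close> the function \<open>crit\<close> equals \<open>g\<close>, whose
  derivative is positive because \<open>2 x \<phi>(x) \<le> 0.8\<close>. A sign change between 0 and
  0.256 gives the root, and monotonicity makes the definite description meaningful.\<close>

lemma C_star_less_256: "C_star < 0.256"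
  and C_star_pos: "0 < C_star"
  and crit_C_star: "crit C_star = 0"
proof -
  define g where "g x = 4 * (std_normal_density x)\<^sup>2 + 4 * integral {0..x} std_normal_density - 1" for x
  have g: "g x = crit x" if "0 \<le> x" for x
    using half_line_Phi[OF that] by (simp add: g_def)
  have deriv: "(g has_real_derivative 4 * std_normal_density x * (1 - 2 * x * std_normal_density x)) (at x within {0..1})"
    if "x \<in> {0..1}" for x
    unfolding g_def
    by (rule derivative_eq_intros integral_has_real_derivative[OF continuous_std_normal_density that]
        DERIV_subset[OF DERIV_std_normal_density] refl subset_UNIV | simp)+ (simp add: algebra_simps power2_eq_square)
  have cont: "continuous_on {0..1} g"
    using deriv by (rule DERIV_continuous_on)
  have mono: "g x < g y" if "0 \<le> x" "x < y" "y \<le> 1" for x y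
  proof (rule DERIV_pos_imp_increasing_open[OF \<open>x < y\<close>])
    fix t assume t: "x < t" "t < y"
    then have "t \<in> interior {0..1}" "t \<in> {0..1}"
      using that by auto
    then have "(g has_real_derivative 4 * std_normal_density t * (1 - 2 * t * std_normal_density t)) (at t)"
      using deriv[of t] at_within_interior[of t "{0..1}"] by simp
    moreover have "t * std_normal_density t \<le> 1 * 0.4"
      using t that std_normal_density_le[of t] by (intro mult_mono) auto
    then have "4 * std_normal_density t * (1 - 2 * t * std_normal_density t) > 0"
      by (intro mult_pos_pos) (simp_all add: std_normal_density_pos)
    ultimately show "\<exists>y. (g has_real_derivative y) (at t) \<and> 0 < y"
      by blast
  next
    show "continuous_on {x..y} g"
      using that by (intro continuous_on_subset[OF cont]) auto
  qed
  have g0: "g 0 < 0"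
  proof -
    have "4 * (std_normal_density 0)\<^sup>2 < 1"
      using pi_approx by (simp add: std_normal_density_sq divide_simps)
    then show ?thesis by (simp add: g_def)
  qed
  have "g 0.256 = crit 0.256"
    by (rule g) simp
  then have g1: "g 0.256 > 0"
    using crit_pos by (simp only:)
  have "\<exists>c\<ge>0. c \<le> 0.256 \<and> g c = 0"
    using g0 g1 by (intro IVT') (auto intro: continuous_on_subset[OF cont])
  then obtain c where c: "0 \<le> c" "c \<le> 0.256" "g c = 0"
    by blast
  have "c \<noteq> 0.256"
  proof
    assume eq: "c = 0.256"
    have "g c > 0" unfolding eq by (rule g1)
    with c show False by simp
  qed
  moreover have "c \<noteq> 0"
    using c g0 by auto
  ultimately have c': "0 < c" "c < 0.256"
    using c by linarith+
  have unique: "y = c" if "0 < y" "y < 1" "crit y = 0" for y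
    using mono[of y c] mono[of c y] c c' that g[of y] by (cases y c rule: linorder_cases) auto
  have crit_c: "crit c = 0"
    using c g[of c] by simp
  have "c < 1"
    by (rule order.strict_trans[OF c'(2)]) simp
  with c' crit_c unique have ex1: "\<exists>!C. 0 < C \<and> C < 1 \<and> crit C = 0"
    by blast
  have "C_star = c"
    unfolding C_star_def by (rule the1_equality[OF ex1]) (use c' \<open>c < 1\<close> crit_c in blast)
  then show "C_star < 0.256" "0 < C_star" "crit C_star = 0"
    using c' crit_c by (simp_all only:)
qed

section \<open>Numerical bounds at the critical point\<close>

lemma C_star_sq_le: "C_star\<^sup>2 \<le> 0.065536"
proof -
  have "C_star\<^sup>2 \<le> 0.256\<^sup>2"
    using C_star_pos C_star_less_256 by (intro power_mono) auto
  then show ?thesis by (simp add: power2_eq_square[of "32 / 125"])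
qed

lemma C_star_density_sq:
  shows "(std_normal_density C_star)\<^sup>2 \<ge> 0.14905" and "(std_normal_density C_star)\<^sup>2 \<le> 0.159155"
proof -
  have "exp (- 0.065536) \<le> exp (- C_star\<^sup>2)"
    using C_star_sq_le by simp
  then have "0.93652 \<le> exp (- C_star\<^sup>2)"
    using exp_minus_bound by linarith
  then have "0.93652 / (2 * 3.1416) \<le> exp (- C_star\<^sup>2) / (2 * pi)"
    using pi_approx by (intro frac_le) auto
  then show "(std_normal_density C_star)\<^sup>2 \<ge> 0.14905"
    unfolding std_normal_density_sq by simp
  have "exp (- C_star\<^sup>2) / (2 * pi) \<le> 1 / (2 * 3.14159265)"
    using pi_approx by (intro frac_le) auto
  then show "(std_normal_density C_star)\<^sup>2 \<le> 0.159155"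
    unfolding std_normal_density_sq by simp
qed

lemma C_star_density_bounds:
  shows "0.77 \<le> 2 * std_normal_density C_star" and "2 * std_normal_density C_star \<le> 0.798"
proof -
  have sq: "(2 * std_normal_density C_star)\<^sup>2 = 4 * (std_normal_density C_star)\<^sup>2"
    by (simp add: power_mult_distrib)
  have "0.77\<^sup>2 \<le> (2 * std_normal_density C_star)\<^sup>2"
    unfolding sq using C_star_density_sq(1) by (simp add: power2_eq_square[of "77 / 100"])
  then show "0.77 \<le> 2 * std_normal_density C_star"
    by (rule power2_le_imp_le) simp
  have "(2 * std_normal_density C_star)\<^sup>2 \<le> 0.798\<^sup>2"
    unfolding sq using C_star_density_sq(2) by (simp add: power2_eq_square[of "399 / 500"])
  then show "2 * std_normal_density C_star \<le> 0.798"
    by (rule power2_le_imp_le) simp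
qed

text \<open>The defining equation of \<open>C_star\<close> expresses the probability of the strip
  through the density at its edge.\<close>

lemma strip_mass: "1 - 2 * Phi (- C_star) = 1 / 2 - 2 * (std_normal_density C_star)\<^sup>2"
  using crit_C_star by simp

text \<open>The strip has mass at least about 0.18, while a density below 0.4 gives it at most
  \<open>0.8 * C_star\<close>. The bound later admits margins up to 0.1 in
  \<open>outer_sign_deficit\<close>.\<close>

lemma C_star_ge: "0.2 \<le> C_star"
proof -
  have "integral {0..C_star} std_normal_density \<le> integral {0..C_star} (\<lambda>_. 0.4)"
    using std_normal_density_le
    by (intro integral_le integrable_continuous_real continuous_std_normal_density) auto
  also have "\<dots> = 0.4 * C_star"
    using C_star_pos by simp
  finally show ?thesis
    using strip_mass half_line_Phi[of C_star] C_star_pos C_star_density_sq(2) by simp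
qed

text \<open>The origin of 0.046: the squared level-3 contribution of the truncated sign minus the
  squared strip mass. The first term increases and the second decreases in \<open>X\<close>, so the
  lower bound 0.14905 serves both; the margin is about 0.000005.\<close>

lemma level_3_gap:
  defines "X \<equiv> (std_normal_density C_star)\<^sup>2"
  shows "0.046 \<le> 2 / 3 * (1 - C_star\<^sup>2)\<^sup>2 * X - (1 / 2 - 2 * X)\<^sup>2"
proof -
  have "(1 - 0.065536)\<^sup>2 \<le> (1 - C_star\<^sup>2)\<^sup>2"
    using C_star_sq_le by (intro power_mono) auto
  then have "0.87322 \<le> (1 - C_star\<^sup>2)\<^sup>2"
    by (simp add: power2_eq_square[of "14601 / 15625"])
  then have "2 / 3 * 0.87322 * 0.14905 \<le> 2 / 3 * (1 - C_star\<^sup>2)\<^sup>2 * X"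
    using C_star_density_sq(1) unfolding X_def by (intro mult_mono) auto
  moreover have "(1 / 2 - 2 * X)\<^sup>2 \<le> (1 / 2 - 2 * 0.14905)\<^sup>2"
    using C_star_density_sq unfolding X_def by (intro power_mono) auto
  moreover have "(1 / 2 - 2 * 0.14905 :: real)\<^sup>2 = 0.04076361"
    by (simp add: power2_eq_square)
  ultimately show ?thesis
    by simp
qed

section \<open>The quadratic forms of the Hermite projections\<close>

lemma has_bochner_integral_gauss_coord:
  fixes F :: "real \<Rightarrow> real"
  assumes "has_bochner_integral gauss1 F I"
  shows "has_bochner_integral std_gaussian (\<lambda>x :: real ^ 'n. F (x $ i)) I"
proof -
  interpret prob_space gauss1 by (rule prob_space_gauss1)
  let ?F = "\<lambda>j. if j = i then F else (\<lambda>_. 1)"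
  have "has_bochner_integral std_gaussian (\<lambda>x :: real ^ 'n. \<Prod>j\<in>UNIV. ?F j (x $ j)) (\<Prod>j\<in>UNIV. \<integral>x. ?F j x \<partial>gauss1)"
    using assms by (intro has_bochner_integral_gauss_prod) (auto simp: has_bochner_integral_iff)
  moreover have "(\<Prod>j\<in>UNIV. ?F j (x $ j)) = F (x $ i)" for x :: "real ^ 'n"
    using prod.delta[of UNIV i "\<lambda>j. F (x $ j)"] by (simp add: if_distribR cong: if_cong)
  moreover have "(\<integral>x. ?F j x \<partial>gauss1) = (if j = i then I else 1)" for j
    using assms prob_space by (auto simp: has_bochner_integral_iff)
  ultimately show ?thesis
    by simp
qed

lemma has_bochner_integral_gauss_coord_mult:
  fixes F G :: "real \<Rightarrow> real"
  assumes "has_bochner_integral gauss1 F I" "has_bochner_integral gauss1 G J" "i \<noteq> j"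
  shows "has_bochner_integral std_gaussian (\<lambda>x :: real ^ 'n. F (x $ i) * G (x $ j)) (I * J)"
proof -
  interpret prob_space gauss1 by (rule prob_space_gauss1)
  let ?F = "\<lambda>l. if l = i then F else if l = j then G else (\<lambda>_. 1)"
  have "has_bochner_integral std_gaussian (\<lambda>x :: real ^ 'n. \<Prod>l\<in>UNIV. ?F l (x $ l)) (\<Prod>l\<in>UNIV. \<integral>x. ?F l x \<partial>gauss1)"
    using assms by (intro has_bochner_integral_gauss_prod) (auto simp: has_bochner_integral_iff)
  moreover have "(\<Prod>l\<in>UNIV. if l = i then u l else if l = j then v l else 1) = u i * (v j :: real)" for u v
  proof -
    have "(\<Prod>l\<in>UNIV. if l = i then u l else if l = j then v l else 1)
        = (\<Prod>l\<in>UNIV. (if l = i then u l else 1) * (if l = j then v l else 1))"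
      using \<open>i \<noteq> j\<close> by (intro prod.cong) auto
    then show ?thesis by (simp add: prod.distrib)
  qed
  moreover have "(\<integral>x. ?F l x \<partial>gauss1) = (if l = i then I else if l = j then J else 1)" for l
    using assms prob_space by (auto simp: has_bochner_integral_iff)
  moreover have "?F l (x $ l) = (if l = i then F (x $ l) else if l = j then G (x $ l) else 1)" for l and x :: "real ^ 'n"
    by simp
  ultimately show ?thesis
    by simp
qed

lemma He_multi_single: "He_multi ((\<lambda>_. 0)(i := k)) x = poly (He k) (x $ i)"
proof -
  have "He_multi ((\<lambda>_. 0)(i := k)) x = (\<Prod>j\<in>UNIV. if j = i then poly (He k) (x $ j) else 1)"
    unfolding He_multi_def by (intro prod.cong) auto
  then show ?thesis by simp
qed

lemma mfact_single: "mfact ((\<lambda>_. 0)(i := k)) = fact k"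
proof -
  have "mfact ((\<lambda>_. 0)(i := k)) = (\<Prod>j\<in>UNIV. if j = i then fact k else 1)"
    by (intro prod.cong) auto
  then show ?thesis by simp
qed

text \<open>Level 1 sees only the barycentres: it is their Euclidean inner product.\<close>

lemma level_1_eq:
  fixes f g :: "real ^ 'n \<Rightarrow> real"
  shows "level 1 f g = (\<Sum>i\<in>UNIV. gauss_inner f (\<lambda>x. x $ i) * gauss_inner g (\<lambda>x. x $ i))"
proof -
  have inj: "inj (\<lambda>i :: 'n. (\<lambda>_. 0 :: nat)(i := 1))"
    by (auto simp: inj_def fun_eq_iff split: if_splits)
  have "He_multi ((\<lambda>_. 0)(i := 1)) = (\<lambda>x. x $ i)" for i :: 'n
    by (rule ext) (simp add: He_multi_single[of i 1, simplified])
  then show ?thesis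
    unfolding level_def multi_indices_1 sum.reindex[OF inj]
    by (simp add: hermite_coeff_def mfact_single[of _ 1, simplified])
qed

lemma level_nonneg: "0 \<le> level k f f"
  unfolding level_def by (intro sum_nonneg divide_nonneg_nonneg less_imp_le[OF mfact_pos]) simp

text \<open>All terms of the sum are nonnegative; only the multi-index concentrated at
  \<open>i\<close> is kept.\<close>

lemma level_ge_single:
  "(gauss_inner f (\<lambda>x. poly (He k) (x $ i)))\<^sup>2 / fact k \<le> level k f f"
proof -
  define \<alpha> :: "'a \<Rightarrow> nat" where "\<alpha> = (\<lambda>_. 0)(i := k)"
  have "\<alpha> \<in> multi_indices k"
    by (simp add: multi_indices_def \<alpha>_def)
  moreover have "0 \<le> hermite_coeff f \<beta> * hermite_coeff f \<beta> / mfact \<beta>" for \<beta>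
    by (intro divide_nonneg_nonneg less_imp_le[OF mfact_pos]) simp
  ultimately have "hermite_coeff f \<alpha> * hermite_coeff f \<alpha> / mfact \<alpha> \<le> level k f f"
    unfolding level_def using finite_multi_indices by (intro member_le_sum) auto
  moreover have "mfact \<alpha> = fact k"
    unfolding \<alpha>_def by (rule mfact_single)
  moreover have "He_multi \<alpha> = (\<lambda>x. poly (He k) (x $ i))"
    unfolding \<alpha>_def by (intro ext He_multi_single)
  ultimately show ?thesis
    by (simp add: hermite_coeff_def power2_eq_square)
qed

text \<open>The form is bilinear and symmetric, so the cross terms cancel.\<close>

lemma level_polarization:
  assumes a: "a \<in> unit_functions" and b: "b \<in> unit_functions"
  shows "level k (\<lambda>x. a x + b x) (\<lambda>x. a x - b x) = level k a a - level k b b"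
proof -
  have i: "integrable std_gaussian (\<lambda>x. a x * He_multi \<alpha> x)" "integrable std_gaussian (\<lambda>x. b x * He_multi \<alpha> x)" for \<alpha>
    using integrable_unit_mult[OF _ integrable_He_multi] a b by auto
  have "hermite_coeff (\<lambda>x. a x + b x) \<alpha> = hermite_coeff a \<alpha> + hermite_coeff b \<alpha>"
    "hermite_coeff (\<lambda>x. a x - b x) \<alpha> = hermite_coeff a \<alpha> - hermite_coeff b \<alpha>" for \<alpha>
    using i by (simp_all add: hermite_coeff_def gauss_inner_def distrib_right left_diff_distrib)
  then have "hermite_coeff (\<lambda>x. a x + b x) \<alpha> * hermite_coeff (\<lambda>x. a x - b x) \<alpha> / mfact \<alpha>
      = hermite_coeff a \<alpha> * hermite_coeff a \<alpha> / mfact \<alpha> - hermite_coeff b \<alpha> * hermite_coeff b \<alpha> / mfact \<alpha>" for \<alpha>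
    by (simp only: diff_divide_distrib[symmetric]) (simp add: algebra_simps)
  then show ?thesis
    by (simp add: level_def sum_subtractf)
qed

lemma level_eq_norm_proj:
  assumes b: "b \<in> unit_functions"
  shows "level k b b = gauss_inner (hermite_proj k b) b"
    and "level k b b = gauss_inner (hermite_proj k b) (hermite_proj k b)"
proof -
  show "level k b b = gauss_inner (hermite_proj k b) b"
    using gauss_inner_hermite_proj[OF b b] by simp
  then show "level k b b = gauss_inner (hermite_proj k b) (hermite_proj k b)"
    unfolding gauss_inner_hermite_proj_span[OF b hermite_proj_in_span[OF b]]
    by (simp add: gauss_inner_def mult.commute)
qed

lemma integrable_std_gaussian_bounded:
  fixes f :: "real ^ 'n \<Rightarrow> real"
  assumes "f \<in> borel_measurable borel" "\<And>x. \<bar>f x\<bar> \<le> B"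
  shows "integrable std_gaussian f"
proof -
  interpret prob_space "std_gaussian :: (real ^ 'n) measure" by (rule prob_space_std_gaussian)
  show ?thesis
    using assms by (intro integrable_const_bound[of _ B]) (auto intro!: AE_I2)
qed

text \<open>With \<open>h\<close> the projection of \<open>b\<close>, the pointwise bound
  \<open>b h \<le> (1 + h^2) / 2\<close> integrates to \<open>L \<le> (1 + L) / 2\<close>, because
  \<open>L\<close> is both the mean of \<open>b h\<close> and that of \<open>h^2\<close>.\<close>

lemma level_le_1:
  fixes b :: "real ^ 'n \<Rightarrow> real"
  assumes b: "b \<in> unit_functions"
  shows "level k b b \<le> 1"
proof -
  interpret prob_space "std_gaussian :: (real ^ 'n) measure" by (rule prob_space_std_gaussian)
  define h where "h = hermite_proj k b"
  have h: "h \<in> hermite_span k"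
    unfolding h_def by (rule hermite_proj_in_span[OF b])
  have ih: "integrable std_gaussian (\<lambda>x. h x * h x)"
    by (rule hermite_span_integrable_mult[OF h h])
  have "level k b b = (\<integral>x. b x * h x \<partial>std_gaussian)"
    using level_eq_norm_proj(1)[OF b, of k] by (simp add: gauss_inner_def h_def mult.commute)
  also have "\<dots> \<le> (\<integral>x. (1 + h x * h x) / 2 \<partial>std_gaussian)"
  proof (rule integral_mono)
    show "integrable std_gaussian (\<lambda>x. b x * h x)"
      by (rule integrable_unit_mult[OF b hermite_span_integrable[OF h]])
    show "integrable std_gaussian (\<lambda>x. (1 + h x * h x) / 2)"
      using ih by simp
    fix x
    have "b x * b x \<le> 1"
      using b by (simp add: unit_functions_def abs_square_le_1[of "b x", unfolded power2_eq_square])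
    then show "b x * h x \<le> (1 + h x * h x) / 2"
      using sum_squares_ge_zero[of "b x - h x" 0] by (simp add: algebra_simps)
  qed
  also have "\<dots> = (1 + level k b b) / 2"
    using ih level_eq_norm_proj(2)[OF b, of k] prob_space by (simp add: gauss_inner_def h_def)
  finally show ?thesis by simp
qed

section \<open>Functions concentrated on a strip have little weight on a Hermite level\<close>

lemma strip_indicator_eq: "indicator {x. \<bar>x\<bar> < c} x = (1 - \<bar>outer_sign c x\<bar> :: real)" if "c > 0"
  using that by (auto simp: outer_sign_def indicator_def)

lemma strip_mass_gauss1:
  assumes "c > 0"
  shows "has_bochner_integral gauss1 (indicator {x. \<bar>x\<bar> < c}) (1 - 2 * Phi (- c))"
proof -
  interpret prob_space gauss1 by (rule prob_space_gauss1)
  have "has_bochner_integral gauss1 (\<lambda>x. 1 - \<bar>outer_sign c x\<bar>) (1 - 2 * Phi (- c))"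
    using prob_space by (intro has_bochner_integral_diff abs_outer_sign_moment_0[OF assms])
      (simp add: has_bochner_integral_iff)
  moreover have "(\<lambda>x. 1 - \<bar>outer_sign c x\<bar>) = indicator {x. \<bar>x\<bar> < c}"
    using strip_indicator_eq[OF assms] by auto
  ultimately show ?thesis by simp
qed

text \<open>
  Conditioning on the coordinate \<open>x\<^sub>i\<close> inside a strip cannot increase the second moment of an element
  of the Hermite space: the cross terms still vanish, since two multi-indices of the same
  degree that differ do so in a coordinate other than \<open>i\<close>.
\<close>

lemma hermite_span_strip:
  fixes h :: "real ^ 'n \<Rightarrow> real"
  assumes h: "h \<in> hermite_span k" and c: "c > 0"
    and bound: "\<And>m x. m \<le> k \<Longrightarrow> \<bar>x\<bar> < c \<Longrightarrow> (poly (He m) x)\<^sup>2 \<le> fact m"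
  shows "(\<integral>x. indicator {x. \<bar>x\<bar> < c} (x $ i) * (h x * h x) \<partial>std_gaussian) \<le> (1 - 2 * Phi (- c)) * gauss_inner h h"
proof -
  let ?S = "{x. \<bar>x\<bar> < c} :: real set"
  let ?p = "1 - 2 * Phi (- c)"
  obtain d where d: "h = (\<lambda>x. \<Sum>\<alpha>\<in>multi_indices k. d \<alpha> * He_multi \<alpha> x)"
    using h unfolding hermite_span_def by blast
  have S: "?p = (\<integral>x. indicator ?S x \<partial>gauss1)"
    using strip_mass_gauss1[OF c] by (simp add: has_bochner_integral_iff)
  have i1: "integrable gauss1 (\<lambda>x. poly p x * poly q x)" for p q
    using integrable_gauss1_poly[of "p * q"] unfolding poly_mult .
  have [measurable]: "poly p \<in> borel_measurable borel" for p :: "real poly"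
    by (intro borel_measurable_continuous_onI continuous_intros)
  have i2: "integrable gauss1 (\<lambda>x. indicator ?S x * (poly p x * poly q x))" for p q
    by (rule Bochner_Integration.integrable_bound[OF i1[of p q]]) (auto simp: indicator_def)
  \<comment> \<open>The inner product restricted to the strip: coordinate \<open>i\<close> carries
    the indicator, the other coordinates keep their orthogonality.\<close>
  define w :: "('n \<Rightarrow> nat) \<Rightarrow> ('n \<Rightarrow> nat) \<Rightarrow> real" where
    "w \<alpha> \<beta> = (\<integral>x. indicator ?S x * (poly (He (\<alpha> i)) x * poly (He (\<beta> i)) x) \<partial>gauss1) *
      (\<Prod>j\<in>UNIV - {i}. if \<alpha> j = \<beta> j then fact (\<beta> j) else 0)" for \<alpha> \<beta>
  have w: "has_bochner_integral std_gaussian (\<lambda>x. indicator ?S (x $ i) * (He_multi \<alpha> x * He_multi \<beta> x)) (w \<alpha> \<beta>)" for \<alpha> \<beta>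
  proof -
    let ?F = "\<lambda>j x. (if j = i then indicator ?S x else 1) * (poly (He (\<alpha> j)) x * poly (He (\<beta> j)) x) :: real"
    have "integrable gauss1 (?F j)" for j
      by (cases "j = i") (simp_all add: i1 i2)
    then have "has_bochner_integral std_gaussian (\<lambda>x :: real ^ 'n. \<Prod>j\<in>UNIV. ?F j (x $ j)) (\<Prod>j\<in>UNIV. \<integral>x. ?F j x \<partial>gauss1)"
      by (rule has_bochner_integral_gauss_prod)
    moreover have "(\<Prod>j\<in>UNIV. ?F j (x $ j)) = indicator ?S (x $ i) * (He_multi \<alpha> x * He_multi \<beta> x)" for x
      unfolding prod.distrib He_multi_def by simp
    moreover have "(\<Prod>j\<in>UNIV. \<integral>x. ?F j x \<partial>gauss1) = w \<alpha> \<beta>"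
      unfolding w_def by (subst prod.remove[of _ i]) (auto simp: gauss1_He_orthogonal intro!: prod.cong)
    ultimately show ?thesis by simp
  qed
  have w_zero: "w \<alpha> \<beta> = 0" if "\<alpha> \<in> multi_indices k" "\<beta> \<in> multi_indices k" "\<alpha> \<noteq> \<beta>" for \<alpha> \<beta>
  proof -
    have "\<exists>j\<in>UNIV - {i}. \<alpha> j \<noteq> \<beta> j"
    proof (rule ccontr)
      assume "\<not> ?thesis"
      then have eq: "\<alpha> j = \<beta> j" if "j \<noteq> i" for j
        using that by blast
      then have "sum \<alpha> (UNIV - {i}) = sum \<beta> (UNIV - {i})"
        by (intro sum.cong) auto
      moreover have "sum \<alpha> UNIV = \<alpha> i + sum \<alpha> (UNIV - {i})" "sum \<beta> UNIV = \<beta> i + sum \<beta> (UNIV - {i})"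
        by (auto intro: sum.remove)
      ultimately have "\<alpha> i = \<beta> i"
        using that(1,2) by (simp add: multi_indices_def)
      with eq have "\<alpha> = \<beta>" by (metis ext)
      with that show False by simp
    qed
    then show ?thesis
      unfolding w_def by (auto simp: prod_zero_iff)
  qed
  have w_diag: "w \<alpha> \<alpha> \<le> ?p * mfact \<alpha>" if "\<alpha> \<in> multi_indices k" for \<alpha>
  proof -
    have "\<alpha> i \<le> k"
      using that member_le_sum[of i UNIV \<alpha>] by (simp add: multi_indices_def)
    have "(\<integral>x. indicator ?S x * (poly (He (\<alpha> i)) x * poly (He (\<alpha> i)) x) \<partial>gauss1)
        \<le> (\<integral>x. fact (\<alpha> i) * indicator ?S x \<partial>gauss1)"
    proof (rule integral_mono[OF i2])
      show "integrable gauss1 (\<lambda>x. fact (\<alpha> i) * indicator ?S x :: real)"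
        using strip_mass_gauss1[OF c] by (intro integrable_mult_right) (simp add: has_bochner_integral_iff)
      show "indicator ?S x * (poly (He (\<alpha> i)) x * poly (He (\<alpha> i)) x) \<le> fact (\<alpha> i) * (indicator ?S x :: real)" for x
        using bound[OF \<open>\<alpha> i \<le> k\<close>, of x] by (simp add: indicator_def power2_eq_square)
    qed
    also have "\<dots> = fact (\<alpha> i) * ?p"
      unfolding S by simp
    finally have "w \<alpha> \<alpha> \<le> fact (\<alpha> i) * ?p * (\<Prod>j\<in>UNIV - {i}. fact (\<alpha> j))"
      unfolding w_def by (simp add: mult_right_mono prod_nonneg)
    also have "\<dots> = ?p * mfact \<alpha>"
      by (subst prod.remove[of UNIV i]) auto
    finally show ?thesis .
  qed
  let ?M = "multi_indices k :: ('n \<Rightarrow> nat) set"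
  have "(\<integral>x. indicator ?S (x $ i) * (h x * h x) \<partial>std_gaussian)
      = (\<integral>x. (\<Sum>\<alpha>\<in>?M. \<Sum>\<beta>\<in>?M. d \<alpha> * d \<beta> * (indicator ?S (x $ i) * (He_multi \<alpha> x * He_multi \<beta> x))) \<partial>std_gaussian)"
    unfolding d sum_product by (simp add: sum_distrib_left mult_ac)
  also have "\<dots> = (\<Sum>\<alpha>\<in>?M. \<Sum>\<beta>\<in>?M. d \<alpha> * d \<beta> * w \<alpha> \<beta>)"
    using w by (intro has_bochner_integral_integral_eq has_bochner_integral_sum has_bochner_integral_mult_right) auto
  also have "\<dots> = (\<Sum>\<alpha>\<in>?M. \<Sum>\<beta>\<in>?M. if \<beta> = \<alpha> then d \<alpha> * d \<alpha> * w \<alpha> \<alpha> else 0)"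
    by (intro sum.cong refl) (auto simp: w_zero)
  also have "\<dots> = (\<Sum>\<alpha>\<in>?M. d \<alpha> * d \<alpha> * w \<alpha> \<alpha>)"
    by (simp add: finite_multi_indices)
  also have "\<dots> \<le> (\<Sum>\<alpha>\<in>?M. d \<alpha> * d \<alpha> * (?p * mfact \<alpha>))"
    by (intro sum_mono mult_left_mono w_diag) auto
  also have "\<dots> = ?p * gauss_inner h h"
  proof -
    have "gauss_inner h h = (\<Sum>\<alpha>\<in>?M. d \<alpha> * gauss_inner h (He_multi \<alpha>))"
    proof -
      have "gauss_inner h h = (\<integral>x. (\<Sum>\<alpha>\<in>?M. d \<alpha> * (h x * He_multi \<alpha> x)) \<partial>std_gaussian)"
        unfolding gauss_inner_def by (subst (2) d) (simp add: sum_distrib_left mult_ac)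
      also have "\<dots> = (\<Sum>\<alpha>\<in>?M. d \<alpha> * gauss_inner h (He_multi \<alpha>))"
        using hermite_span_integrable_mult[OF h He_multi_in_hermite_span[OF refl]]
        by (subst Bochner_Integration.integral_sum) (auto simp: gauss_inner_def)
      finally show ?thesis .
    qed
    also have "\<dots> = (\<Sum>\<alpha>\<in>?M. d \<alpha> * (d \<alpha> * mfact \<alpha>))"
      by (intro sum.cong refl) (simp add: d gauss_inner_span_He_multi)
    finally show ?thesis
      by (simp add: sum_distrib_left mult_ac)
  qed
  finally show ?thesis .
qed

text \<open>A pointwise substitute for Cauchy-Schwarz, with \<open>\<kappa>\<close> set to the ratio
  of the expected norms.\<close>

lemma weighted_am_gm:
  fixes u v \<kappa> :: real
  assumes "\<kappa> > 0"
  shows "u * v \<le> (\<kappa> * u\<^sup>2 + (v * v) / \<kappa>) / 2"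
  using assms sum_squares_ge_zero[of "\<kappa> * u - v" 0] by (simp add: field_simps power2_eq_square)

text \<open>Let \<open>H\<close> be the norm of the projection \<open>h\<close>, so
  \<open>H^2\<close> is the mean of \<open>b h\<close>. On the strip, weight \<open>H\<close>
  together with \<open>hermite_span_strip\<close> gives at most \<open>H * p\<close>, where
  \<open>p\<close> is the strip mass; off the strip, weight \<open>H / \<beta>\<close> gives at most
  \<open>H * \<beta>\<close>. Dividing by \<open>H\<close> bounds the norm.\<close>

lemma level_strip_le:
  fixes b :: "real ^ 'n \<Rightarrow> real"
  assumes b: "b \<in> unit_functions" and c: "c > 0" and \<beta>: "\<beta> > 0"
    and bound: "\<And>m x. m \<le> k \<Longrightarrow> \<bar>x\<bar> < c \<Longrightarrow> (poly (He m) x)\<^sup>2 \<le> fact m"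
    and outside: "(\<integral>x. (b x)\<^sup>2 * \<bar>outer_sign c (x $ i)\<bar> \<partial>std_gaussian) \<le> \<beta>\<^sup>2"
  shows "level k b b \<le> (1 - 2 * Phi (- c) + \<beta>)\<^sup>2"
proof -
  let ?p = "1 - 2 * Phi (- c)"
  let ?S = "\<lambda>x :: real ^ 'n. indicator {x. \<bar>x\<bar> < c} (x $ i) :: real"
  have [measurable]: "b \<in> borel_measurable borel"
    by (rule unit_functions_borel[OF b])
  have S: "has_bochner_integral std_gaussian ?S ?p"
    by (rule has_bochner_integral_gauss_coord[OF strip_mass_gauss1[OF c]])
  then have "?p = (\<integral>x. ?S x \<partial>std_gaussian)"
    by (simp add: has_bochner_integral_iff)
  then have p0: "0 \<le> ?p"
    by simp
  define h where "h = hermite_proj k b"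
  have h: "h \<in> hermite_span k"
    unfolding h_def by (rule hermite_proj_in_span[OF b])
  note [measurable] = hermite_span_borel[OF h]
  define H where "H = sqrt (level k b b)"
  have H0: "0 \<le> H" and H2: "level k b b = H\<^sup>2"
    using level_nonneg[of k b] by (auto simp: H_def)
  have ih: "integrable std_gaussian (\<lambda>x. h x * h x)"
    by (rule hermite_span_integrable_mult[OF h h])
  have iSh: "integrable std_gaussian (\<lambda>x. ?S x * (h x * h x))"
    by (rule Bochner_Integration.integrable_bound[OF ih]) (auto simp: indicator_def)
  have hh: "(\<integral>x. h x * h x \<partial>std_gaussian) = H\<^sup>2"
    using level_eq_norm_proj(2)[OF b, of k] H2 by (simp add: gauss_inner_def h_def)
  have ib: "integrable std_gaussian (\<lambda>x. (b x)\<^sup>2 * \<bar>outer_sign c (x $ i)\<bar>)"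
  proof (rule integrable_std_gaussian_bounded[of _ 1])
    show "\<bar>(b x)\<^sup>2 * \<bar>outer_sign c (x $ i)\<bar>\<bar> \<le> 1" for x
      using b abs_outer_sign_le[of c "x $ i"] by (auto simp: unit_functions_def abs_mult abs_square_le_1 intro!: mult_le_one)
  qed measurable
  show ?thesis
  proof (cases "H = 0")
    case True
    then show ?thesis using H2 by simp
  next
    case False
    with H0 have Hp: "H > 0" by simp
    have "H\<^sup>2 = (\<integral>x. b x * h x \<partial>std_gaussian)"
      using level_eq_norm_proj(1)[OF b, of k] H2 by (simp add: gauss_inner_def h_def mult.commute)
    also have "\<dots> \<le> (\<integral>x. (H * ?S x + (?S x * (h x * h x)) / H
        + (H / \<beta>) * ((b x)\<^sup>2 * \<bar>outer_sign c (x $ i)\<bar>) + (\<beta> / H) * (h x * h x)) / 2 \<partial>std_gaussian)"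
    proof (rule integral_mono)
      show "integrable std_gaussian (\<lambda>x. b x * h x)"
        by (rule integrable_unit_mult[OF b hermite_span_integrable[OF h]])
      show "integrable std_gaussian (\<lambda>x. (H * ?S x + (?S x * (h x * h x)) / H
        + (H / \<beta>) * ((b x)\<^sup>2 * \<bar>outer_sign c (x $ i)\<bar>) + (\<beta> / H) * (h x * h x)) / 2)"
        using S iSh ib ih by (intro integrable_divide Bochner_Integration.integrable_add integrable_mult_right)
          (auto simp: has_bochner_integral_iff)
      fix x :: "real ^ 'n"
      show "b x * h x \<le> (H * ?S x + (?S x * (h x * h x)) / H
        + (H / \<beta>) * ((b x)\<^sup>2 * \<bar>outer_sign c (x $ i)\<bar>) + (\<beta> / H) * (h x * h x)) / 2"
      proof (cases "\<bar>x $ i\<bar> < c")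
        case True
        have "b x * h x \<le> (H * (b x)\<^sup>2 + (h x * h x) / H) / 2"
          by (rule weighted_am_gm[OF Hp])
        also have "\<dots> \<le> (H * 1 + (h x * h x) / H) / 2"
          using b Hp by (intro divide_right_mono add_right_mono mult_left_mono) (auto simp: unit_functions_def abs_square_le_1)
        also have "\<dots> \<le> (H * 1 + (h x * h x) / H + (\<beta> / H) * (h x * h x)) / 2"
          using Hp \<beta> by simp
        finally show ?thesis
          using True strip_indicator_eq[OF c, of "x $ i"] by simp
      next
        case False
        have "b x * h x \<le> ((H / \<beta>) * (b x)\<^sup>2 + (h x * h x) / (H / \<beta>)) / 2"
          using Hp \<beta> by (intro weighted_am_gm) simp
        moreover have "\<bar>outer_sign c (x $ i)\<bar> = 1"
          using False c by (auto simp: outer_sign_def)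
        ultimately show ?thesis
          using False by (simp add: mult_ac)
      qed
    qed
    also have "\<dots> = (H * ?p + (\<integral>x. ?S x * (h x * h x) \<partial>std_gaussian) / H
        + (H / \<beta>) * (\<integral>x. (b x)\<^sup>2 * \<bar>outer_sign c (x $ i)\<bar> \<partial>std_gaussian) + (\<beta> / H) * H\<^sup>2) / 2"
      using S iSh ib ih hh by (simp add: has_bochner_integral_iff)
    also have "\<dots> \<le> (H * ?p + (?p * H\<^sup>2) / H + (H / \<beta>) * \<beta>\<^sup>2 + (\<beta> / H) * H\<^sup>2) / 2"
      using hermite_span_strip[OF h c bound, of i] hh Hp \<beta> outside
      by (intro divide_right_mono add_mono mult_left_mono order.refl) (auto simp: gauss_inner_def)
    also have "\<dots> = H * (?p + \<beta>)"
      using Hp \<beta> by (simp add: field_simps power2_eq_square)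
    finally have "H \<le> ?p + \<beta>"
      using Hp by (simp add: power2_eq_square)
    then show ?thesis
      unfolding H2 using H0 by (rule power_mono)
  qed
qed

text \<open>The truncated sign maximizes \<open>a x - C \<bar>a\<bar>\<close> pointwise. Any other
  choice costs at least the distance of \<open>\<bar>x\<bar>\<close> from \<open>C\<close>, hence at
  least \<open>\<eta>\<close> outside the band paid for by the indicator. A flipped sign has squared
  difference 4 but costs \<open>2 \<bar>x\<bar> \<ge> 2 C\<close>; this is where
  \<open>\<eta> \<le> C / 2\<close> enters.\<close>

lemma outer_sign_deficit:
  fixes a x C \<eta> :: real
  assumes a: "a \<in> {-1, 0, 1}" and C: "C > 0" and \<eta>: "\<eta> > 0"
  defines "\<tau> \<equiv> (outer_sign C x * x - C * \<bar>outer_sign C x\<bar>) - (a * x - C * \<bar>a\<bar>)"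
  shows "\<eta> * \<bar>\<bar>a\<bar> - \<bar>outer_sign C x\<bar>\<bar> \<le> \<tau> + \<eta> * indicator {x. \<bar>\<bar>x\<bar> - C\<bar> < \<eta>} x"
    and "\<eta> \<le> C / 2 \<Longrightarrow> \<eta> * (a - outer_sign C x)\<^sup>2 \<le> \<tau> + \<eta> * indicator {x. \<bar>\<bar>x\<bar> - C\<bar> < \<eta>} x"
    and "0 \<le> \<tau>"
proof -
  define \<iota> :: real where "\<iota> = indicator {x. \<bar>\<bar>x\<bar> - C\<bar> < \<eta>} x"
  have \<iota>: "\<iota> = 1 \<or> \<iota> = 0 \<and> \<eta> \<le> \<bar>\<bar>x\<bar> - C\<bar>"
    by (auto simp: \<iota>_def indicator_def)
  from a consider "a = -1" | "a = 0" | "a = 1" by auto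
  then have "\<eta> * \<bar>\<bar>a\<bar> - \<bar>outer_sign C x\<bar>\<bar> \<le> \<tau> + \<eta> * \<iota> \<and>
    (\<eta> \<le> C / 2 \<longrightarrow> \<eta> * (a - outer_sign C x)\<^sup>2 \<le> \<tau> + \<eta> * \<iota>) \<and> 0 \<le> \<tau>"
  proof cases
    case 1
    show ?thesis
      unfolding \<tau>_def 1 outer_sign_def using \<iota> C \<eta> by (elim disjE conjE; simp; arith)
  next
    case 2
    show ?thesis
      unfolding \<tau>_def 2 outer_sign_def using \<iota> C \<eta> by (elim disjE conjE; simp; arith)
  next
    case 3
    show ?thesis
      unfolding \<tau>_def 3 outer_sign_def using \<iota> C \<eta> by (elim disjE conjE; simp; arith)
  qed
  then show "\<eta> * \<bar>\<bar>a\<bar> - \<bar>outer_sign C x\<bar>\<bar> \<le> \<tau> + \<eta> * indicator {x. \<bar>\<bar>x\<bar> - C\<bar> < \<eta>} x"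
    "\<eta> \<le> C / 2 \<Longrightarrow> \<eta> * (a - outer_sign C x)\<^sup>2 \<le> \<tau> + \<eta> * indicator {x. \<bar>\<bar>x\<bar> - C\<bar> < \<eta>} x"
    "0 \<le> \<tau>"
    unfolding \<iota>_def by blast+
qed

text \<open>Here \<open>y\<close> is the error in the first moment and \<open>q\<close> the error in
  mass. The gain \<open>y^2\<close> has to be beaten by \<open>2 s \<rho> \<ge> 1.54 \<rho>\<close>.
  For small \<open>\<rho>\<close> the bound on \<open>q\<close> makes \<open>y\<close> of order
  \<open>sqrt \<rho>\<close>, with a small constant because \<open>C\<close> is small; for larger
  \<open>\<rho>\<close> the crude bounds on \<open>q\<close> and \<open>y\<close> suffice.\<close>

lemma deficit_dichotomy:
  fixes s C \<rho> y q :: real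
  assumes s: "0.77 \<le> s" "s \<le> 0.798" and C: "0 \<le> C" "C \<le> 0.256" and \<rho>: "0 \<le> \<rho>"
    and y: "y = \<rho> + C * q" "\<bar>y\<bar> \<le> s" and q1: "\<bar>q\<bar> \<le> 1"
    and q: "\<And>\<eta>. \<eta> > 0 \<Longrightarrow> \<eta> * \<bar>q\<bar> \<le> \<rho> + \<eta> * (1.6 * \<eta>)"
  shows "2 * s * \<rho> - y\<^sup>2 \<ge> \<rho> / 2 \<or> 2 * s * \<rho> - y\<^sup>2 \<ge> 0.001"
proof -
  define z where "z = 2 * s * \<rho>"
  have s\<rho>: "1.54 * \<rho> \<le> z"
    unfolding z_def using s \<rho> by (intro mult_right_mono) auto
  have Cq: "\<bar>C * q\<bar> \<le> 0.256 * \<bar>q\<bar>"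
    using C unfolding abs_mult by (intro mult_right_mono) auto
  have y_le: "\<bar>y\<bar> \<le> \<rho> + 0.256 * \<bar>q\<bar>"
    using y(1) Cq \<rho> by linarith
  consider "\<rho> = 0" | "0 < \<rho>" "\<rho> \<le> 0.12" | "0.12 \<le> \<rho>" "\<rho> \<le> 0.4" | "0.4 \<le> \<rho>"
    using \<rho> by linarith
  then have "z - y\<^sup>2 \<ge> \<rho> / 2 \<or> z - y\<^sup>2 \<ge> 0.001" (is ?goal)
  proof cases
    case 1
    \<comment> \<open>For \<open>\<rho> = 0\<close> the hypothesis reads
      \<open>\<bar>q\<bar> \<le> 1.6 * \<eta>\<close> for every \<open>\<eta>\<close>, which forces
      \<open>q = 0\<close>.\<close>
    have "\<bar>q\<bar> \<le> 0 + e" if "e > 0" for e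
    proof -
      have "(e / 1.6) * \<bar>q\<bar> \<le> (e / 1.6) * e"
        using q[of "e / 1.6"] that 1 by simp
      then show ?thesis
        using that by (simp add: mult_le_cancel_left)
    qed
    then have "\<bar>q\<bar> \<le> 0"
      by (rule field_le_epsilon)
    then show ?goal
      using 1 y(1) by (simp add: z_def)
  next
    case 2
    define r where "r = sqrt \<rho>"
    have r: "0 < r" "\<rho> = r * r"
      using 2 by (auto simp: r_def)
    have "r * r \<le> 0.3465 * 0.3465"
      using r 2 by simp
    then have r_le: "r \<le> 0.3465"
      using mult_strict_mono[of "0.3465" r "0.3465" r] by (simp add: not_le) (metis not_le)
    \<comment> \<open>The choice \<open>\<eta> = sqrt \<rho>\<close> balances the two error
      terms.\<close>
    have "r * \<bar>q\<bar> \<le> r * (2.6 * r)"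
      using q[OF r(1)] unfolding r(2) by (simp add: algebra_simps)
    then have "\<bar>q\<bar> \<le> 2.6 * r"
      using r(1) by (simp add: mult_le_cancel_left)
    then have "0.256 * \<bar>q\<bar> \<le> 0.256 * (2.6 * r)"
      by (intro mult_left_mono) auto
    then have "\<bar>y\<bar> \<le> r * r + 0.256 * (2.6 * r)"
      by (intro order_trans[OF y_le[unfolded r(2)] add_left_mono])
    also have "\<dots> = r * (r + 0.6656)"
      by (simp add: algebra_simps)
    also have "\<dots> \<le> r * 1.0121"
      using r r_le by (intro mult_left_mono) auto
    finally have "\<bar>y\<bar>\<^sup>2 \<le> (r * 1.0121)\<^sup>2"
      by (rule power_mono) simp
    also have "\<dots> \<le> 1.04 * \<rho>"
      unfolding r(2) by (simp add: power2_eq_square)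
    finally show ?goal
      using s\<rho> by simp
  next
    case 3
    have "\<bar>y\<bar> \<le> \<rho> + 0.256"
      using y_le q1 by simp
    then have "\<bar>y\<bar>\<^sup>2 \<le> (\<rho> + 0.256)\<^sup>2"
      by (rule power_mono) simp
    also have "(\<rho> + 0.256)\<^sup>2 \<le> 1.54 * \<rho> - 0.001"
    proof -
      \<comment> \<open>On this interval the chord between its endpoints bounds the square from
        above.\<close>
      have "0 \<le> (\<rho> - 0.12) * (0.4 - \<rho>)"
        using 3 by (intro mult_nonneg_nonneg) auto
      also have "\<dots> = 0.52 * \<rho> - 0.048 - \<rho> * \<rho>"
        by (simp add: algebra_simps) (simp add: field_simps)
      finally have "\<rho> * \<rho> \<le> 0.52 * \<rho> - 0.048"
        by simp
      moreover have "(\<rho> + 0.256)\<^sup>2 = \<rho> * \<rho> + 0.512 * \<rho> + 0.065536"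
        by (simp add: power2_eq_square algebra_simps)
      ultimately show ?thesis
        using 3 by simp
    qed
    finally show ?goal
      using s\<rho> 3 by simp
  next
    case 4
    \<comment> \<open>With \<open>\<rho> \<ge> 0.4\<close> the deficit is at least
      \<open>s * (0.8 - s)\<close>, positive since \<open>s \<le> 0.798\<close>.\<close>
    have "\<bar>y\<bar>\<^sup>2 \<le> s\<^sup>2"
      using y(2) by (rule power_mono) simp
    moreover have "2 * s * 0.4 \<le> z"
      unfolding z_def using 4 s by (intro mult_left_mono) auto
    moreover have "0.77 * 0.002 \<le> s * (0.8 - s)"
      using s by (intro mult_mono) auto
    ultimately show ?goal
      by (simp add: power2_eq_square algebra_simps)
  qed
  then show ?thesis
    unfolding z_def .
qed

section \<open>Stability of the optimal pair\<close>

text \<open>The value of the first operator at the optimal pair: the squared length of the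
  barycentre of the truncated sign, minus \<open>lambda_star\<close> times the correlation of the
  pair.\<close>

definition opt_value :: real where
  "opt_value = (2 * std_normal_density C_star)\<^sup>2 - lambda_star * (4 * Phi (- C_star) - 1)"

lemma He_bound:
  assumes "m \<le> 3" "\<bar>x\<bar> < C_star"
  shows "(poly (He m) x)\<^sup>2 \<le> fact m"
proof -
  have "\<bar>x\<bar> \<le> 1 / 2"
    using assms(2) C_star_less_256 by simp
  then have y: "x\<^sup>2 \<le> 1 / 4"
    using power_mono[of "\<bar>x\<bar>" "1 / 2" 2] by (simp add: power2_eq_square)
  consider "m = 0" | "m = 1" | "m = 2" | "m = 3"
    using assms(1) by linarith
  then show ?thesis
  proof cases
    case 3
    have "(x\<^sup>2 - 1)\<^sup>2 \<le> 1"
      unfolding abs_square_le_1 using y zero_le_power2[of x] by linarith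
    moreover have "poly (He 2) x = x\<^sup>2 - 1"
      by (simp add: numeral_2_eq_2)
    ultimately show ?thesis
      using 3 by simp
  next
    case 4
    have "(x\<^sup>2 - 3)\<^sup>2 \<le> 3\<^sup>2"
      using y abs_le_square_iff[of "x\<^sup>2 - 3" 3] by simp
    then have "x\<^sup>2 * (x\<^sup>2 - 3)\<^sup>2 \<le> 1 / 4 * 3\<^sup>2"
      using y by (intro mult_mono) auto
    moreover have "poly (He 3) x = x * (x\<^sup>2 - 3)"
      by (simp add: numeral_3_eq_3 power2_eq_square algebra_simps)
    ultimately show ?thesis
      using 4 by (simp add: power_mult_distrib fact_numeral)
  qed (use y in auto)
qed

lemma strip_mass_le: "1 - 2 * Phi (- C_star) \<le> 0.202"
  using strip_mass C_star_density_sq(1) by simp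

text \<open>
  The whole analysis takes place in coordinates in which the barycentre of the part where
  \<open>f = g\<close> lies on the \<open>i\<close>-th axis.
\<close>

context
  fixes f g a b :: "real ^ 'n \<Rightarrow> real" and i :: 'n
  assumes f: "f \<in> sign_functions" and g: "g \<in> sign_functions"
    and a_def: "a = (\<lambda>x. (f x + g x) / 2)" and b_def: "b = (\<lambda>x. (f x - g x) / 2)"
    and perp: "\<And>j. j \<noteq> i \<Longrightarrow> gauss_inner a (\<lambda>x. x $ j) = 0"
    and nonneg: "0 \<le> gauss_inner a (\<lambda>x. x $ i)"
begin

private abbreviation "\<gamma> \<equiv> std_gaussian :: (real ^ 'n) measure"
private abbreviation "os \<equiv> \<lambda>x :: real ^ 'n. outer_sign C_star (x $ i)"

text \<open>The first moment of the optimal \<open>os\<close>. Its counterpart \<open>m\<close> for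
  \<open>a\<close> is the length of the barycentre, by \<open>perp\<close> and
  \<open>nonneg\<close>, and \<open>P\<close> is the probability that \<open>f\<close> and
  \<open>g\<close> agree.\<close>

private definition "s = 2 * std_normal_density C_star"
private definition "m = (\<integral>x. a x * x $ i \<partial>\<gamma>)"
private definition "P = (\<integral>x. \<bar>a x\<bar> \<partial>\<gamma>)"
private definition "\<rho> = (\<integral>x. (os x * x $ i - C_star * \<bar>os x\<bar>) - (a x * x $ i - C_star * \<bar>a x\<bar>) \<partial>\<gamma>)"

section \<open>The deficit of an aligned pair\<close>

private lemma meas [measurable]:
  "f \<in> borel_measurable borel" "g \<in> borel_measurable borel"
  "a \<in> borel_measurable borel" "b \<in> borel_measurable borel"
  using f g unfolding a_def b_def sign_functions_def by auto

private lemma fg_values: "f x = 1 \<or> f x = -1" "g x = 1 \<or> g x = -1"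
  using f g unfolding sign_functions_def by auto

private lemma a_values: "a x \<in> {-1, 0, 1}"
  using fg_values[of x] unfolding a_def by auto

private lemma a_unit: "a \<in> unit_functions" and b_unit: "b \<in> unit_functions"
  and abs_a_unit: "(\<lambda>x. \<bar>a x\<bar>) \<in> unit_functions"
  and os_unit: "os \<in> unit_functions" and abs_os_unit: "(\<lambda>x. \<bar>os x\<bar>) \<in> unit_functions"
proof -
  have "\<bar>a x\<bar> \<le> 1" "\<bar>b x\<bar> \<le> 1" for x
    using fg_values[of x] unfolding a_def b_def by auto
  then show "a \<in> unit_functions" "b \<in> unit_functions" "(\<lambda>x. \<bar>a x\<bar>) \<in> unit_functions"
    by (auto simp: unit_functions_def)
  show "os \<in> unit_functions" "(\<lambda>x. \<bar>os x\<bar>) \<in> unit_functions"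
    using abs_outer_sign_le by (auto simp: unit_functions_def)
qed

private lemma integrable_coord: "integrable \<gamma> (\<lambda>x. x $ i)"
  using integrable_He_multi[of "(\<lambda>_. 0)(i := 1)"] unfolding He_multi_single by simp

private lemma integrable_unit: "u \<in> unit_functions \<Longrightarrow> integrable \<gamma> u"
  by (rule integrable_std_gaussian_bounded[of _ 1]) (auto simp: unit_functions_def)

private lemma integrable_unit_coord: "u \<in> unit_functions \<Longrightarrow> integrable \<gamma> (\<lambda>x. u x * x $ i)"
  by (rule integrable_unit_mult[OF _ integrable_coord])

private lemma int_os_coord: "(\<integral>x. os x * x $ i \<partial>\<gamma>) = s"
  using has_bochner_integral_gauss_coord[OF outer_sign_moment_1[OF C_star_pos], of i]
  by (simp add: has_bochner_integral_iff s_def)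

private lemma int_abs_os: "(\<integral>x. \<bar>os x\<bar> \<partial>\<gamma>) = 2 * Phi (- C_star)"
  using has_bochner_integral_gauss_coord[OF abs_outer_sign_moment_0[OF C_star_pos], of i]
  by (simp add: has_bochner_integral_iff)

private lemma integrable_pieces:
  "integrable \<gamma> (\<lambda>x. os x * x $ i - C_star * \<bar>os x\<bar>)" "integrable \<gamma> (\<lambda>x. a x * x $ i - C_star * \<bar>a x\<bar>)"
  using integrable_unit_coord[OF os_unit] integrable_unit_coord[OF a_unit]
    integrable_unit[OF abs_os_unit] integrable_unit[OF abs_a_unit]
  by auto

private lemma \<rho>_eq: "\<rho> = (s - m) + C_star * (P - 2 * Phi (- C_star))"
proof -
  have "\<rho> = (s - C_star * (2 * Phi (- C_star))) - (m - C_star * P)"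
    unfolding \<rho>_def
    using integrable_pieces integrable_unit_coord[OF os_unit] integrable_unit_coord[OF a_unit]
      integrable_unit[OF abs_os_unit] integrable_unit[OF abs_a_unit]
    by (simp add: int_os_coord int_abs_os m_def P_def)
  then show ?thesis by (simp add: algebra_simps)
qed

private lemma prob_near:
  assumes "\<eta> > 0"
  shows "integrable \<gamma> (\<lambda>x. indicator {x. \<bar>\<bar>x\<bar> - C_star\<bar> < \<eta>} (x $ i) :: real)"
    and "(\<integral>x. indicator {x. \<bar>\<bar>x\<bar> - C_star\<bar> < \<eta>} (x $ i) \<partial>\<gamma>) \<le> 1.6 * \<eta>"
proof -
  interpret prob_space gauss1 by (rule prob_space_gauss1)
  have "integrable gauss1 (indicator {x. \<bar>\<bar>x\<bar> - C_star\<bar> < \<eta>} :: real \<Rightarrow> real)"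
    by (intro integrable_const_bound[of _ 1]) auto
  then have "has_bochner_integral gauss1 (indicator {x. \<bar>\<bar>x\<bar> - C_star\<bar> < \<eta>} :: real \<Rightarrow> real)
      (\<integral>x. indicator {x. \<bar>\<bar>x\<bar> - C_star\<bar> < \<eta>} x \<partial>gauss1)"
    by (simp add: has_bochner_integral_iff)
  from has_bochner_integral_gauss_coord[OF this, of i] gauss1_near_le[of \<eta> C_star] assms
  show "integrable \<gamma> (\<lambda>x. indicator {x. \<bar>\<bar>x\<bar> - C_star\<bar> < \<eta>} (x $ i) :: real)"
    "(\<integral>x. indicator {x. \<bar>\<bar>x\<bar> - C_star\<bar> < \<eta>} (x $ i) \<partial>\<gamma>) \<le> 1.6 * \<eta>"
    by (simp_all add: has_bochner_integral_iff)
qed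

text \<open>Integrates the pointwise bounds of \<open>outer_sign_deficit\<close>; the band around
  the edges of the strip costs its probability, at most \<open>1.6 * \<eta>\<close>.\<close>

private lemma \<rho>_dominates:
  assumes \<eta>: "\<eta> > 0" and w: "integrable \<gamma> w"
    and le: "\<And>x. \<eta> * w x \<le> (os x * x $ i - C_star * \<bar>os x\<bar>) - (a x * x $ i - C_star * \<bar>a x\<bar>)
      + \<eta> * indicator {x. \<bar>\<bar>x\<bar> - C_star\<bar> < \<eta>} (x $ i)"
  shows "\<eta> * (\<integral>x. w x \<partial>\<gamma>) \<le> \<rho> + \<eta> * (1.6 * \<eta>)"
proof -
  let ?I = "\<lambda>x. indicator {x. \<bar>\<bar>x\<bar> - C_star\<bar> < \<eta>} (x $ i) :: real"
  have d: "integrable \<gamma> (\<lambda>x. (os x * x $ i - C_star * \<bar>os x\<bar>) - (a x * x $ i - C_star * \<bar>a x\<bar>))"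
    by (intro Bochner_Integration.integrable_diff integrable_pieces)
  have I: "integrable \<gamma> (\<lambda>x. \<eta> * ?I x)"
    using prob_near(1)[OF \<eta>] by (rule integrable_mult_right)
  have "\<eta> * (\<integral>x. w x \<partial>\<gamma>) = (\<integral>x. \<eta> * w x \<partial>\<gamma>)"
    by simp
  also have "\<dots> \<le> (\<integral>x. ((os x * x $ i - C_star * \<bar>os x\<bar>) - (a x * x $ i - C_star * \<bar>a x\<bar>)) + \<eta> * ?I x \<partial>\<gamma>)"
    by (rule integral_mono[OF integrable_mult_right[OF w] Bochner_Integration.integrable_add[OF d I] le])
  also have "\<dots> = \<rho> + \<eta> * (\<integral>x. ?I x \<partial>\<gamma>)"
    unfolding \<rho>_def by (subst Bochner_Integration.integral_add[OF d I]) simp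
  also have "\<dots> \<le> \<rho> + \<eta> * (1.6 * \<eta>)"
    using prob_near(2)[OF \<eta>] \<eta> by (intro add_left_mono mult_left_mono) auto
  finally show ?thesis .
qed

private lemma \<rho>_nonneg: "0 \<le> \<rho>"
  unfolding \<rho>_def using outer_sign_deficit(3)[OF a_values C_star_pos zero_less_one]
  by (intro integral_nonneg_AE AE_I2)

private lemma P_bounds: "0 \<le> P" "P \<le> 1"
proof -
  interpret prob_space \<gamma> by (rule prob_space_std_gaussian)
  show "0 \<le> P" unfolding P_def by simp
  have "P \<le> (\<integral>x. 1 \<partial>\<gamma>)"
    unfolding P_def using a_unit
    by (intro integral_mono integrable_unit[OF abs_a_unit]) (auto simp: unit_functions_def)
  then show "P \<le> 1" using prob_space by simp
qed

private lemma Pstar_bounds: "0 \<le> 2 * Phi (- C_star)" "2 * Phi (- C_star) \<le> 1"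
proof -
  interpret prob_space \<gamma> by (rule prob_space_std_gaussian)
  show "0 \<le> 2 * Phi (- C_star)" unfolding int_abs_os[symmetric] by simp
  have "(\<integral>x. \<bar>os x\<bar> \<partial>\<gamma>) \<le> (\<integral>x. 1 \<partial>\<gamma>)"
    using os_unit by (intro integral_mono integrable_unit[OF abs_os_unit]) (auto simp: unit_functions_def)
  then show "2 * Phi (- C_star) \<le> 1" unfolding int_abs_os using prob_space by simp
qed

private lemma mass_difference:
  assumes "\<eta> > 0"
  shows "\<eta> * \<bar>2 * Phi (- C_star) - P\<bar> \<le> \<rho> + \<eta> * (1.6 * \<eta>)"
proof -
  have i: "integrable \<gamma> (\<lambda>x. \<bar>\<bar>a x\<bar> - \<bar>os x\<bar>\<bar>)"
    using integrable_unit[OF abs_a_unit] integrable_unit[OF abs_os_unit] by auto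
  have "2 * Phi (- C_star) - P = (\<integral>x. \<bar>os x\<bar> - \<bar>a x\<bar> \<partial>\<gamma>)"
    using integrable_unit[OF abs_a_unit] integrable_unit[OF abs_os_unit] by (simp add: P_def int_abs_os)
  also have "\<bar>\<dots>\<bar> \<le> (\<integral>x. \<bar>\<bar>os x\<bar> - \<bar>a x\<bar>\<bar> \<partial>\<gamma>)"
    by (rule integral_abs_bound)
  also have "\<dots> = (\<integral>x. \<bar>\<bar>a x\<bar> - \<bar>os x\<bar>\<bar> \<partial>\<gamma>)"
    by (simp add: abs_minus_commute)
  finally have "\<eta> * \<bar>2 * Phi (- C_star) - P\<bar> \<le> \<eta> * (\<integral>x. \<bar>\<bar>a x\<bar> - \<bar>os x\<bar>\<bar> \<partial>\<gamma>)"
    using assms by (intro mult_left_mono) auto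
  also have "\<dots> \<le> \<rho> + \<eta> * (1.6 * \<eta>)"
    using outer_sign_deficit(1)[OF a_values C_star_pos assms] by (intro \<rho>_dominates[OF assms i])
  finally show ?thesis .
qed

private lemma int_sq_diff:
  assumes "\<eta> > 0" "\<eta> \<le> C_star / 2"
  shows "integrable \<gamma> (\<lambda>x. (a x - os x)\<^sup>2)"
    and "\<eta> * (\<integral>x. (a x - os x)\<^sup>2 \<partial>\<gamma>) \<le> \<rho> + \<eta> * (1.6 * \<eta>)"
proof -
  have "\<bar>(a x - os x)\<^sup>2\<bar> \<le> 4" for x
  proof -
    have "\<bar>a x - os x\<bar> \<le> 2"
      using a_unit os_unit by (auto simp: unit_functions_def intro: abs_triangle_ineq4[THEN order_trans] dest!: spec[of _ x])
    then show ?thesis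
      using power_mono[of "\<bar>a x - os x\<bar>" 2 2] by simp
  qed
  then show i: "integrable \<gamma> (\<lambda>x. (a x - os x)\<^sup>2)"
    by (intro integrable_std_gaussian_bounded[of _ 4]) auto
  show "\<eta> * (\<integral>x. (a x - os x)\<^sup>2 \<partial>\<gamma>) \<le> \<rho> + \<eta> * (1.6 * \<eta>)"
    using outer_sign_deficit(2)[OF a_values C_star_pos assms(1) assms(2)] by (intro \<rho>_dominates[OF assms(1) i])
qed

text \<open>The crude upper bound is enough for \<open>\<bar>s - m\<bar> \<le> s\<close>, because
  \<open>2 * s \<ge> 1.54\<close>.\<close>

private lemma m_bounds: "0 \<le> m" "m \<le> 1"
proof -
  interpret prob_space \<gamma> by (rule prob_space_std_gaussian)
  show "0 \<le> m" using nonneg by (simp add: m_def gauss_inner_def)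
  have sq: "has_bochner_integral \<gamma> (\<lambda>x. x $ i * x $ i) 1"
    using has_bochner_integral_He_multi[of "(\<lambda>_. 0)(i := 1)" "(\<lambda>_. 0)(i := 1)"]
    unfolding He_multi_single mfact_single by simp
  have "m \<le> (\<integral>x. (1 + x $ i * x $ i) / 2 \<partial>\<gamma>)"
    unfolding m_def
  proof (rule integral_mono[OF integrable_unit_coord[OF a_unit]])
    show "integrable \<gamma> (\<lambda>x. (1 + x $ i * x $ i) / 2)"
      using sq by (simp add: has_bochner_integral_iff)
    fix x :: "real ^ 'n"
    have "a x * x $ i \<le> \<bar>x $ i\<bar>"
      using a_values[of x] by auto
    also have "\<dots> \<le> (1 + x $ i * x $ i) / 2"
      using sum_squares_ge_zero[of "\<bar>x $ i\<bar> - 1" 0] by (simp add: algebra_simps)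
    finally show "a x * x $ i \<le> (1 + x $ i * x $ i) / 2" .
  qed
  also have "\<dots> = 1"
    using sq prob_space by (simp add: has_bochner_integral_iff)
  finally show "m \<le> 1" .
qed

private lemma levels:
  "level k f g = level k a a - level k b b"
proof -
  have "f = (\<lambda>x. a x + b x)" "g = (\<lambda>x. a x - b x)"
    by (auto simp: a_def b_def field_simps)
  then show ?thesis
    using level_polarization[OF a_unit b_unit, of k] by simp
qed

private lemma level_1_a: "level 1 a a = m\<^sup>2"
proof -
  have "level 1 a a = (\<Sum>j\<in>UNIV. if j = i then m\<^sup>2 else 0)"
    unfolding level_1_eq by (intro sum.cong) (auto simp: perp[unfolded gauss_inner_def] m_def gauss_inner_def power2_eq_square)
  then show ?thesis by simp
qed

private lemma inner_fg: "gauss_inner f g = 2 * P - 1"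
proof -
  interpret prob_space \<gamma> by (rule prob_space_std_gaussian)
  have "f x * g x = 2 * \<bar>a x\<bar> - 1" for x
    using fg_values[of x] unfolding a_def by auto
  then show ?thesis
    using integrable_unit[OF abs_a_unit] prob_space by (simp add: gauss_inner_def P_def)
qed

text \<open>Expand \<open>m^2\<close> around \<open>s\<close>. Since
  \<open>lambda_star = C_star * s\<close>, the term linear in the mass \<open>P\<close> is absorbed
  exactly by \<open>\<rho>\<close>, and only the square of \<open>s - m\<close> is left as a
  gain.\<close>

private lemma deficit:
  "level 1 f g - lambda_star * gauss_inner f g = opt_value - (2 * s * \<rho> - (s - m)\<^sup>2) - level 1 b b"
proof -
  have "lambda_star = C_star * s"
    by (simp add: lambda_star_def s_def)
  then show ?thesis
    unfolding levels level_1_a inner_fg opt_value_def \<rho>_eq s_def[symmetric] \<open>lambda_star = C_star * s\<close>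
    by (simp add: power2_eq_square algebra_simps)
qed

private lemma dichotomy:
  "2 * s * \<rho> - (s - m)\<^sup>2 \<ge> \<rho> / 2 \<or> 2 * s * \<rho> - (s - m)\<^sup>2 \<ge> 0.001"
proof (rule deficit_dichotomy)
  show s: "0.77 \<le> s" "s \<le> 0.798"
    using C_star_density_bounds by (simp_all add: s_def)
  show "0 \<le> C_star" "C_star \<le> 0.256"
    using C_star_pos C_star_less_256 by simp_all
  show "s - m = \<rho> + C_star * (2 * Phi (- C_star) - P)"
    unfolding \<rho>_eq by (simp add: algebra_simps)
  show "\<bar>s - m\<bar> \<le> s"
    using s m_bounds by (simp add: abs_le_iff)
  show "\<bar>2 * Phi (- C_star) - P\<bar> \<le> 1"
    using P_bounds Pstar_bounds by linarith
qed (use \<rho>_nonneg mass_difference in auto)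

lemma aligned_bound_0: "level 1 f g - lambda_star * gauss_inner f g \<le> opt_value"
  unfolding deficit using dichotomy \<rho>_nonneg level_nonneg[of 1 b] by auto

section \<open>Level 3 of a near-optimal pair\<close>

private lemma level_3_ge_minus_1: "- 1 \<le> level 3 f g"
  using level_le_1[OF b_unit, of 3] level_nonneg[of 3 a] unfolding levels by linarith

text \<open>\<open>He 3\<close> has norm \<open>sqrt 6 < 2.45\<close>, so replacing
  \<open>os\<close> by \<open>a\<close> moves its coefficient \<open>- A\<close> by at most
  \<open>2.45 * \<beta>\<close>. As \<open>A \<le> 0.8\<close>, the loss in the square divided by 6
  is at most \<open>2 * 1.96 * \<beta> / 6\<close>.\<close>

private lemma level_3_a:
  assumes \<beta>: "\<beta> > 0" and i: "integrable \<gamma> (\<lambda>x. (a x - os x)\<^sup>2)" and le: "(\<integral>x. (a x - os x)\<^sup>2 \<partial>\<gamma>) \<le> \<beta>\<^sup>2"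
  shows "2 / 3 * (1 - C_star\<^sup>2)\<^sup>2 * (std_normal_density C_star)\<^sup>2 - 0.66 * \<beta> \<le> level 3 a a"
proof -
  let ?H = "\<lambda>x :: real ^ 'n. poly (He 3) (x $ i)"
  define A where "A = 2 * (1 - C_star\<^sup>2) * std_normal_density C_star"
  have H: "integrable \<gamma> ?H"
    using integrable_He_multi[of "(\<lambda>_. 0)(i := 3)"] unfolding He_multi_single .
  have HH: "has_bochner_integral \<gamma> (\<lambda>x. ?H x * ?H x) 6"
    using has_bochner_integral_He_multi[of "(\<lambda>_. 0)(i := 3)" "(\<lambda>_. 0)(i := 3)"]
    unfolding He_multi_single mfact_single by (simp add: fact_numeral)
  have osH: "(\<integral>x. os x * ?H x \<partial>\<gamma>) = - A"
    using has_bochner_integral_gauss_coord[OF outer_sign_He_3[OF C_star_pos], of i]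
    by (simp add: has_bochner_integral_iff A_def algebra_simps)
  have "(\<integral>x. (a x - os x) * ?H x \<partial>\<gamma>)
      \<le> (\<integral>x. ((2.45 / \<beta>) * (a x - os x)\<^sup>2 + (\<beta> / 2.45) * (?H x * ?H x)) / 2 \<partial>\<gamma>)"
  proof (rule integral_mono)
    show "integrable \<gamma> (\<lambda>x. (a x - os x) * ?H x)"
      unfolding left_diff_distrib using a_unit os_unit H
      by (intro Bochner_Integration.integrable_diff integrable_unit_mult)
    show "integrable \<gamma> (\<lambda>x. ((2.45 / \<beta>) * (a x - os x)\<^sup>2 + (\<beta> / 2.45) * (?H x * ?H x)) / 2)"
      using i HH by (simp add: has_bochner_integral_iff)
    fix x
    have "(a x - os x) * ?H x \<le> ((2.45 / \<beta>) * (a x - os x)\<^sup>2 + (?H x * ?H x) / (2.45 / \<beta>)) / 2"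
      using \<beta> by (intro weighted_am_gm) simp
    also have "(?H x * ?H x) / (2.45 / \<beta>) = (\<beta> / 2.45) * (?H x * ?H x)"
      by simp
    finally show "(a x - os x) * ?H x \<le> ((2.45 / \<beta>) * (a x - os x)\<^sup>2 + (\<beta> / 2.45) * (?H x * ?H x)) / 2" .
  qed
  also have "\<dots> = ((2.45 / \<beta>) * (\<integral>x. (a x - os x)\<^sup>2 \<partial>\<gamma>) + (\<beta> / 2.45) * 6) / 2"
    using i HH by (simp add: has_bochner_integral_iff)
  also have "\<dots> \<le> ((2.45 / \<beta>) * \<beta>\<^sup>2 + (\<beta> / 2.45) * 6) / 2"
    using le \<beta> by (intro divide_right_mono add_right_mono mult_left_mono) auto
  also have "\<dots> \<le> 2.45 * \<beta>"
    using \<beta> by (simp add: power2_eq_square)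
  finally have "(\<integral>x. (a x - os x) * ?H x \<partial>\<gamma>) \<le> 2.45 * \<beta>" .
  moreover have "(\<integral>x. (a x - os x) * ?H x \<partial>\<gamma>) = gauss_inner a ?H + A"
    using integrable_unit_mult[OF a_unit H] integrable_unit_mult[OF os_unit H] osH
    by (simp add: left_diff_distrib gauss_inner_def)
  ultimately have *: "A - 2.45 * \<beta> \<le> - gauss_inner a ?H"
    by linarith
  have A: "0 \<le> A" "A \<le> 0.8"
  proof -
    have "0 \<le> 1 - C_star\<^sup>2" "1 - C_star\<^sup>2 \<le> 1"
      using C_star_sq_le by auto
    moreover have "0 \<le> 2 * std_normal_density C_star" "2 * std_normal_density C_star \<le> 0.8"
      using C_star_density_bounds by simp_all
    ultimately have "0 \<le> (1 - C_star\<^sup>2) * (2 * std_normal_density C_star)"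
      "(1 - C_star\<^sup>2) * (2 * std_normal_density C_star) \<le> 1 * 0.8"
      by (intro mult_nonneg_nonneg mult_mono; simp)+
    moreover have "A = (1 - C_star\<^sup>2) * (2 * std_normal_density C_star)"
      by (simp add: A_def)
    ultimately show "0 \<le> A" "A \<le> 0.8"
      by (simp_all only: mult_1_left)
  qed
  define e where "e = 2.45 * \<beta>"
  have e: "0 \<le> e" "A - e \<le> - gauss_inner a ?H"
    using \<beta> * by (auto simp: e_def)
  \<comment> \<open>If \<open>A \<le> e\<close> the left side is not positive; otherwise
    \<open>A - e\<close> may be squared.\<close>
  have "A\<^sup>2 - 2 * (A * e) \<le> (gauss_inner a ?H)\<^sup>2"
  proof (cases "A \<le> e")
    case True
    then have "A * A \<le> A * e"
      using A(1) by (rule mult_left_mono)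
    moreover have "0 \<le> A * e" "0 \<le> (gauss_inner a ?H)\<^sup>2"
      using A e by simp_all
    ultimately show ?thesis
      unfolding power2_eq_square[of A] by linarith
  next
    case False
    then have "(A - e)\<^sup>2 \<le> (- gauss_inner a ?H)\<^sup>2"
      using e by (intro power_mono) auto
    moreover have "(A - e)\<^sup>2 = A\<^sup>2 - 2 * (A * e) + e\<^sup>2"
      by (simp add: power2_diff)
    moreover have "0 \<le> e\<^sup>2" "(- gauss_inner a ?H)\<^sup>2 = (gauss_inner a ?H)\<^sup>2"
      by simp_all
    ultimately show ?thesis by linarith
  qed
  moreover have "A * e \<le> 0.8 * e"
    using A e by (intro mult_right_mono) auto
  moreover have "0.8 * e \<le> 1.96 * \<beta>"
    by (simp add: e_def)
  ultimately have "A\<^sup>2 / 6 - 0.66 * \<beta> \<le> (gauss_inner a ?H)\<^sup>2 / 6"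
    using \<beta> by simp
  also have "\<dots> \<le> level 3 a a"
    using level_ge_single[of a 3 i] by (simp add: fact_numeral)
  also have "A\<^sup>2 / 6 = 2 / 3 * (1 - C_star\<^sup>2)\<^sup>2 * (std_normal_density C_star)\<^sup>2"
    unfolding A_def power_mult_distrib by simp
  finally show ?thesis .
qed

text \<open>Where \<open>b\<close> is nonzero, \<open>a\<close> vanishes; off the strip
  \<open>a\<close> then differs from \<open>os\<close> by exactly 1. So the mass of \<open>b\<close>
  outside the strip is controlled by the distance from \<open>a\<close> to
  \<open>os\<close>.\<close>

private lemma level_3_b:
  assumes \<beta>: "\<beta> > 0" and i: "integrable \<gamma> (\<lambda>x. (a x - os x)\<^sup>2)" and le: "(\<integral>x. (a x - os x)\<^sup>2 \<partial>\<gamma>) \<le> \<beta>\<^sup>2"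
  shows "level 3 b b \<le> (1 - 2 * Phi (- C_star) + \<beta>)\<^sup>2"
proof (rule level_strip_le[OF b_unit C_star_pos \<beta> He_bound])
  have "(b x)\<^sup>2 * \<bar>os x\<bar> \<le> (a x - os x)\<^sup>2" for x
    using fg_values[of x] unfolding a_def b_def outer_sign_def by auto
  then have "(\<integral>x. (b x)\<^sup>2 * \<bar>os x\<bar> \<partial>\<gamma>) \<le> (\<integral>x. (a x - os x)\<^sup>2 \<partial>\<gamma>)"
  proof (intro integral_mono i)
    show "integrable \<gamma> (\<lambda>x. (b x)\<^sup>2 * \<bar>os x\<bar>)"
    proof (rule integrable_std_gaussian_bounded[of _ 1])
      show "\<bar>(b x)\<^sup>2 * \<bar>os x\<bar>\<bar> \<le> 1" for x
        using b_unit abs_outer_sign_le[of C_star "x $ i"]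
        by (auto simp: unit_functions_def abs_mult abs_square_le_1 intro!: mult_le_one)
    qed measurable
  qed
  with le show "(\<integral>x. (b x)\<^sup>2 * \<bar>os x\<bar> \<partial>\<gamma>) \<le> \<beta>\<^sup>2"
    by linarith
qed

lemma aligned_bound:
  assumes \<epsilon>: "\<epsilon> > 0"
  shows "level 1 f g - lambda_star * gauss_inner f g - \<epsilon> * level 3 f g
    \<le> opt_value - \<epsilon> * (0.046 - 12 * (2 * \<epsilon>) powr (1 / 4))"
proof -
  define t where "t = (2 * \<epsilon>) powr (1 / 4)"
  have t: "t > 0" "t ^ 4 = 2 * \<epsilon>"
    using \<epsilon> by (auto simp: t_def powr_realpow[symmetric] powr_powr)
  define D where "D = 2 * s * \<rho> - (s - m)\<^sup>2"
  have D0: "0 \<le> D"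
    using dichotomy \<rho>_nonneg unfolding D_def by auto
  have J: "level 1 f g - lambda_star * gauss_inner f g \<le> opt_value - D"
    unfolding deficit D_def using level_nonneg[of 1 b] by simp
  have "\<epsilon> * (0.046 - 12 * t) \<le> D + \<epsilon> * level 3 f g"
  proof -
    \<comment> \<open>A deficit of \<open>2 * \<epsilon>\<close> outweighs level 3, which is at
      least -1; for \<open>12 * t \<ge> 1.046\<close> the factor \<open>0.046 - 12 * t\<close> is
      itself at most -1.\<close>
    consider "2 * \<epsilon> \<le> D" | "1.046 \<le> 12 * t" | "D < 2 * \<epsilon>" "12 * t < 1.046"
      by linarith
    then show ?thesis
    proof cases
      case 1
      have "\<epsilon> * (0.046 - 12 * t) \<le> \<epsilon> * (2 + level 3 f g)"
        using \<epsilon> t level_3_ge_minus_1 by (intro mult_left_mono) auto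
      then show ?thesis
        using 1 by (simp add: algebra_simps)
    next
      case 2
      have "\<epsilon> * (0.046 - 12 * t) \<le> \<epsilon> * level 3 f g"
        using \<epsilon> 2 level_3_ge_minus_1 by (intro mult_left_mono) auto
      then show ?thesis
        using D0 by simp
    next
      case 3
      have t_le: "t \<le> 0.0872"
        using 3 by simp
      have "t ^ 4 \<le> 0.0872 ^ 4"
        using t t_le by (intro power_mono) auto
      \<comment> \<open>This rules out the constant alternative of \<open>dichotomy\<close>, so
        \<open>\<rho> \<le> 2 * D\<close>.\<close>
      then have "2 * \<epsilon> < 0.001"
        unfolding t(2) by (simp add: power4_eq_xxxx)
      then have \<rho>_le: "\<rho> \<le> 2 * t ^ 4"
        using dichotomy 3(1) unfolding D_def[symmetric] t(2) by auto
      have t2: "t\<^sup>2 > 0" "t\<^sup>2 \<le> 0.1"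
        using t t_le power_mono[of t "0.0872" 2] by (auto simp: power2_eq_square)
      then have \<eta>: "t\<^sup>2 \<le> C_star / 2"
        using C_star_ge by simp
      let ?I = "\<integral>x. (a x - os x)\<^sup>2 \<partial>\<gamma>"
      have i: "integrable \<gamma> (\<lambda>x. (a x - os x)\<^sup>2)"
        by (rule int_sq_diff(1)[OF t2(1) \<eta>])
      \<comment> \<open>The margin \<open>\<eta> = t\<^sup>2\<close> balances
        \<open>\<rho> / \<eta>\<close> against \<open>1.6 * \<eta>\<close>, as \<open>\<rho>\<close>
        is of order \<open>t ^ 4\<close>. The resulting 3.6 is just below the square of 1.9.\<close>
      have "t\<^sup>2 * ?I \<le> 2 * t ^ 4 + t\<^sup>2 * (1.6 * t\<^sup>2)"
        using int_sq_diff(2)[OF t2(1) \<eta>] \<rho>_le by linarith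
      also have "\<dots> = t\<^sup>2 * (3.6 * t\<^sup>2)"
        by (simp add: power2_eq_square power4_eq_xxxx)
      finally have "?I \<le> 3.6 * t\<^sup>2"
        using t2(1) by (simp add: mult_le_cancel_left)
      also have "\<dots> \<le> (1.9 * t)\<^sup>2"
        by (simp add: power_mult_distrib power2_eq_square)
      finally have I: "?I \<le> (1.9 * t)\<^sup>2" .
      have \<beta>: "1.9 * t > 0"
        using t by simp
      define p where "p = 1 - 2 * Phi (- C_star)"
      have p: "p \<le> 0.202" "0 \<le> p"
        using strip_mass_le Pstar_bounds by (simp_all add: p_def)
      have "(p + 1.9 * t)\<^sup>2 = p\<^sup>2 + (2 * p + 1.9 * t) * (1.9 * t)"
        by (simp add: power2_eq_square algebra_simps)
      also have "(2 * p + 1.9 * t) * (1.9 * t) \<le> 0.6 * (1.9 * t)"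
        using p t t_le by (intro mult_right_mono) auto
      finally have pb: "(p + 1.9 * t)\<^sup>2 \<le> p\<^sup>2 + 0.6 * (1.9 * t)"
        by simp
      have "0.046 \<le> 2 / 3 * (1 - C_star\<^sup>2)\<^sup>2 * (std_normal_density C_star)\<^sup>2 - p\<^sup>2"
        using level_3_gap by (simp add: strip_mass p_def)
      \<comment> \<open>The errors of both level-3 estimates add up to
        \<open>(0.66 + 0.6) * 1.9 * t < 2.4 * t\<close>.\<close>
      then have "0.046 - 12 * t \<le> level 3 f g"
        using level_3_a[OF \<beta> i I] level_3_b[OF \<beta> i I] pb t(1)
        unfolding levels p_def[symmetric] by simp
      then have "\<epsilon> * (0.046 - 12 * t) \<le> \<epsilon> * level 3 f g"
        using \<epsilon> by (intro mult_left_mono) auto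
      then show ?thesis
        using D0 by simp
    qed
  qed
  then show ?thesis
    using J unfolding t_def by simp
qed

end

section \<open>The main theorem\<close>

lemma sign_functions_iff: "f \<in> sign_functions \<longleftrightarrow> f \<in> borel_measurable borel \<and> (\<forall>x. f x \<in> {-1, 1})"
  by (simp only: sign_functions_def mem_Collect_eq)

lemma sign_functions_unit:
  assumes "f \<in> sign_functions"
  shows "f \<in> unit_functions"
proof -
  from assms have f: "f \<in> borel_measurable borel" "\<forall>x. f x \<in> {-1, 1}"
    unfolding sign_functions_iff by blast+
  have "\<forall>x. \<bar>f x\<bar> \<le> 1"
  proof
    fix x
    from f(2) have "f x = -1 \<or> f x = 1"
      by (simp only: insert_iff empty_iff simp_thms)
    then show "\<bar>f x\<bar> \<le> 1"
      by (elim disjE) simp_all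
  qed
  with f(1) show ?thesis
    by (simp only: unit_functions_def mem_Collect_eq simp_thms)
qed

lemma sign_functions_orthogonal:
  fixes R :: "real ^ 'n \<Rightarrow> real ^ 'n"
  assumes R: "orthogonal_transformation R" and f: "f \<in> sign_functions"
  shows "f \<circ> R \<in> sign_functions"
proof -
  have "f \<circ> R \<in> borel_measurable borel"
    using unit_functions_borel[OF unit_functions_orthogonal[OF R sign_functions_unit[OF f]]] .
  then show ?thesis
    using f by (simp only: sign_functions_iff comp_apply) blast
qed

lemma gauss_inner_operator:
  assumes f: "f \<in> unit_functions" and g: "g \<in> unit_functions"
  shows "gauss_inner (\<lambda>x. hermite_proj 1 f x - r * f x) g = level 1 f g - r * gauss_inner f g"
    and "gauss_inner (\<lambda>x. hermite_proj 1 f x - r * f x - \<epsilon> * hermite_proj 3 f x) g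
      = level 1 f g - r * gauss_inner f g - \<epsilon> * level 3 f g"
proof -
  have "integrable std_gaussian (\<lambda>x. g x * hermite_proj k f x)" for k
    by (rule integrable_unit_mult[OF g hermite_span_integrable[OF hermite_proj_in_span[OF f]]])
  then have 1: "integrable std_gaussian (\<lambda>x. hermite_proj k f x * g x)" for k
    by (simp add: mult.commute)
  have 2: "integrable std_gaussian (\<lambda>x. f x * g x)"
    using f g by (intro integrable_unit_mult[OF f] integrable_std_gaussian_bounded[of g 1])
      (auto simp: unit_functions_def)
  show "gauss_inner (\<lambda>x. hermite_proj 1 f x - r * f x) g = level 1 f g - r * gauss_inner f g"
    using 1[of 1] 2 gauss_inner_hermite_proj[OF f g, of 1]
    by (simp add: gauss_inner_def left_diff_distrib mult.assoc)
  show "gauss_inner (\<lambda>x. hermite_proj 1 f x - r * f x - \<epsilon> * hermite_proj 3 f x) g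
      = level 1 f g - r * gauss_inner f g - \<epsilon> * level 3 f g"
    using 1[of 1] 1[of 3] 2 gauss_inner_hermite_proj[OF f g]
    by (simp add: gauss_inner_def left_diff_distrib mult.assoc)
qed

text \<open>Let \<open>R\<close> send the axis vector of length \<open>norm u\<close> to the
  barycentre \<open>u\<close> of \<open>a\<close>. The barycentre of \<open>a \<circ> R\<close> is
  then the preimage of \<open>u\<close>, which lies on the axis.\<close>

lemma align_barycentre:
  fixes a :: "real ^ 'n \<Rightarrow> real" and i :: 'n
  assumes a: "a \<in> unit_functions"
  obtains R where "orthogonal_transformation R"
    "\<And>j. j \<noteq> i \<Longrightarrow> gauss_inner (a \<circ> R) (\<lambda>x. x $ j) = 0" "0 \<le> gauss_inner (a \<circ> R) (\<lambda>x. x $ i)"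
proof -
  define u where "u = (\<chi> j. gauss_inner a (\<lambda>x. x $ j))"
  have *: "norm (norm u *\<^sub>R axis i 1 :: real ^ 'n) = norm u"
    by simp
  obtain R :: "real ^ 'n \<Rightarrow> real ^ 'n"
    where R: "orthogonal_transformation R" "R (norm u *\<^sub>R axis i 1) = u"
    by (rule orthogonal_transformation_exists[OF *])
  have i: "integrable std_gaussian (\<lambda>x :: real ^ 'n. x $ j)" for j
    using integrable_He_multi[of "(\<lambda>_. 0)(j := 1)"] unfolding He_multi_single by simp
  have "gauss_inner (a \<circ> R) (\<lambda>x. x $ j) = norm u * (axis i 1 $ j)" for j
  proof -
    define v where "v = R (axis j 1)"
    have "(\<lambda>x. x $ j) = (\<lambda>y. v \<bullet> y) \<circ> R"
    proof
      fix x
      have "v \<bullet> R x = axis j 1 \<bullet> x"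
        using R(1) by (simp add: v_def orthogonal_transformation_def)
      then show "x $ j = ((\<lambda>y. v \<bullet> y) \<circ> R) x"
        by (simp add: inner_axis' )
    qed
    then have "gauss_inner (a \<circ> R) (\<lambda>x. x $ j) = gauss_inner a (\<lambda>y. v \<bullet> y)"
      using gauss_inner_orthogonal[OF R(1) unit_functions_borel[OF a], of "\<lambda>y. v \<bullet> y"] by simp
    also have "\<dots> = (\<integral>x. (\<Sum>k\<in>UNIV. v $ k * (a x * x $ k)) \<partial>std_gaussian)"
      by (simp add: gauss_inner_def inner_vec_def sum_distrib_left mult.left_commute)
    also have "\<dots> = v \<bullet> u"
      using integrable_unit_mult[OF a i]
      by (subst Bochner_Integration.integral_sum) (auto simp: inner_vec_def u_def gauss_inner_def)
    also have "v \<bullet> u = R (axis j 1) \<bullet> R (norm u *\<^sub>R axis i 1)"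
      unfolding v_def R(2) ..
    also have "\<dots> = (axis j 1 :: real ^ 'n) \<bullet> (norm u *\<^sub>R axis i 1)"
      using R(1) by (simp only: orthogonal_transformation_def)
    finally show ?thesis
      by (simp add: inner_axis')
  qed
  then show thesis
    using that[OF R(1)] by (simp add: axis_def)
qed

text \<open>Levels and inner products are rotation invariant, so the estimates in aligned
  coordinates hold for every pair.\<close>

lemma aligned_pair:
  fixes f g :: "real ^ 'n \<Rightarrow> real"
  assumes f: "f \<in> sign_functions" and g: "g \<in> sign_functions"
  shows "level 1 f g - lambda_star * gauss_inner f g \<le> opt_value"
    and "\<epsilon> > 0 \<Longrightarrow> level 1 f g - lambda_star * gauss_inner f g - \<epsilon> * level 3 f g
      \<le> opt_value - \<epsilon> * (0.046 - 12 * (2 * \<epsilon>) powr (1 / 4))"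
proof -
  fix i :: 'n
  define a where "a = (\<lambda>x. (f x + g x) / 2)"
  have u: "f \<in> unit_functions" "g \<in> unit_functions"
    using f g by (auto intro: sign_functions_unit)
  have "\<bar>a x\<bar> \<le> 1" for x
  proof -
    have "\<bar>f x\<bar> \<le> 1" "\<bar>g x\<bar> \<le> 1"
      using u by (auto simp: unit_functions_def)
    then show ?thesis
      by (auto simp: a_def abs_le_iff)
  qed
  then have a: "a \<in> unit_functions"
    using u by (auto simp: a_def unit_functions_def)
  obtain R :: "real ^ 'n \<Rightarrow> real ^ 'n" where R: "orthogonal_transformation R"
    "\<And>j. j \<noteq> i \<Longrightarrow> gauss_inner (a \<circ> R) (\<lambda>x. x $ j) = 0" "0 \<le> gauss_inner (a \<circ> R) (\<lambda>x. x $ i)"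
    by (rule align_barycentre[OF a, of i]) (rule that)
  have "a \<circ> R = (\<lambda>x. ((f \<circ> R) x + (g \<circ> R) x) / 2)"
    by (auto simp: a_def)
  note R' = sign_functions_orthogonal[OF R(1) f] sign_functions_orthogonal[OF R(1) g] this refl R(2,3)
  have eq: "level k (f \<circ> R) (g \<circ> R) = level k f g" "gauss_inner (f \<circ> R) (g \<circ> R) = gauss_inner f g" for k
    using level_orthogonal[OF R(1) u] gauss_inner_orthogonal[OF R(1)] u[THEN unit_functions_borel] by auto
  show "level 1 f g - lambda_star * gauss_inner f g \<le> opt_value"
    using aligned_bound_0[OF R'] unfolding eq .
  show "level 1 f g - lambda_star * gauss_inner f g - \<epsilon> * level 3 f g
      \<le> opt_value - \<epsilon> * (0.046 - 12 * (2 * \<epsilon>) powr (1 / 4))" if "\<epsilon> > 0"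
    using aligned_bound[OF R' that] unfolding eq .
qed

text \<open>The extremal pair is \<open>a + b\<close> and \<open>a - b\<close>, with
  \<open>a\<close> the truncated sign in one coordinate and \<open>b\<close> the indicator of the
  strip. As \<open>b\<close> is even, it contributes nothing to level 1.\<close>

lemma opt_value_attained:
  obtains f g :: "real ^ 'n \<Rightarrow> real" where "f \<in> sign_functions" "g \<in> sign_functions"
    "level 1 f g - lambda_star * gauss_inner f g = opt_value"
proof -
  interpret prob_space "std_gaussian :: (real ^ 'n) measure" by (rule prob_space_std_gaussian)
  fix i :: 'n
  let ?C = C_star
  define a where "a = (\<lambda>x :: real ^ 'n. outer_sign ?C (x $ i))"
  define b where "b = (\<lambda>x :: real ^ 'n. 1 - \<bar>outer_sign ?C (x $ i)\<bar>)"
  have a: "a \<in> unit_functions" and b: "b \<in> unit_functions"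
    by (auto simp: unit_functions_def a_def b_def outer_sign_def)
  have signs: "(\<lambda>x. a x + b x) \<in> sign_functions" "(\<lambda>x. a x - b x) \<in> sign_functions"
    unfolding sign_functions_def a_def b_def by (auto simp: outer_sign_def)
  have x: "has_bochner_integral gauss1 (\<lambda>x. x) 0"
    using gauss1_stein[of 1] integrable_gauss1_power[of 1] by (simp add: has_bochner_integral_iff)
  have F: "gauss_inner (\<lambda>x. F (x $ i)) (\<lambda>x. x $ j) = 0"
    if "has_bochner_integral gauss1 F I" "j \<noteq> i" for F I j
    using has_bochner_integral_gauss_coord_mult[OF that(1) x that(2)[symmetric]]
    by (simp add: gauss_inner_def has_bochner_integral_iff)
  have abs_os: "has_bochner_integral gauss1 (\<lambda>x. \<bar>outer_sign ?C x\<bar>) (2 * Phi (- ?C))"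
    by (rule abs_outer_sign_moment_0[OF C_star_pos])
  have int1: "integrable gauss1 u" if "u \<in> borel_measurable borel" "\<And>x. \<bar>u x\<bar> \<le> 1" for u :: "real \<Rightarrow> real"
  proof -
    interpret G: prob_space gauss1 by (rule prob_space_gauss1)
    show ?thesis
      using that by (intro G.integrable_const_bound[of _ 1]) auto
  qed
  have a_i: "gauss_inner a (\<lambda>x. x $ i) = 2 * std_normal_density ?C"
    using has_bochner_integral_gauss_coord[OF outer_sign_moment_1[OF C_star_pos], of i]
    by (simp add: gauss_inner_def a_def has_bochner_integral_iff)
  have a_j: "gauss_inner a (\<lambda>x. x $ j) = 0" if "j \<noteq> i" for j
    unfolding a_def by (rule F[OF _ that, of _ "\<integral>x. outer_sign ?C x \<partial>gauss1"])
      (simp add: has_bochner_integral_iff int1 abs_outer_sign_le)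
  have b_i: "gauss_inner b (\<lambda>x. x $ i) = 0"
  proof -
    let ?h = "\<lambda>x. (1 - \<bar>outer_sign ?C x\<bar>) * x"
    have "integrable gauss1 ?h"
      by (rule Bochner_Integration.integrable_bound[of _ "\<lambda>x. x"])
        (use x in \<open>auto simp: has_bochner_integral_iff outer_sign_def\<close>)
    then have h: "has_bochner_integral gauss1 ?h (\<integral>x. ?h x \<partial>gauss1)"
      by (simp add: has_bochner_integral_iff)
    \<comment> \<open>The integrand is odd, so reflection identifies its integral with its own
      negative.\<close>
    have "(\<lambda>x. ?h (- x)) = (\<lambda>x. - ?h x)"
      using C_star_pos by (auto simp: outer_sign_def)
    then have "has_bochner_integral gauss1 (\<lambda>x. - ?h x) (\<integral>x. ?h x \<partial>gauss1)"
      using has_bochner_integral_gauss1_reflect[OF h] by (simp only:)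
    from has_bochner_integral_eq[OF this has_bochner_integral_minus[OF h]]
    have "(\<integral>x. ?h x \<partial>gauss1) = 0"
      by simp
    then show ?thesis
      using has_bochner_integral_gauss_coord[OF h, of i]
      by (simp add: gauss_inner_def b_def has_bochner_integral_iff)
  qed
  have b_j: "gauss_inner b (\<lambda>x. x $ j) = 0" if "j \<noteq> i" for j
    unfolding b_def by (rule F[OF _ that, of _ "\<integral>x. 1 - \<bar>outer_sign ?C x\<bar> \<partial>gauss1"])
      (auto simp: has_bochner_integral_iff outer_sign_def intro!: int1)
  have "level 1 a a = (\<Sum>j\<in>UNIV. if j = i then (2 * std_normal_density ?C)\<^sup>2 else 0)"
    unfolding level_1_eq by (intro sum.cong) (auto simp: a_i a_j power2_eq_square)
  moreover have "gauss_inner b (\<lambda>x. x $ j) = 0" for j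
    by (cases "j = i") (auto intro: b_i b_j)
  then have "level 1 b b = 0"
    unfolding level_1_eq by simp
  ultimately have "level 1 (\<lambda>x. a x + b x) (\<lambda>x. a x - b x) = (2 * std_normal_density ?C)\<^sup>2"
    using level_polarization[OF a b, of 1] by simp
  moreover have "gauss_inner (\<lambda>x. a x + b x) (\<lambda>x. a x - b x) = 4 * Phi (- ?C) - 1"
  proof -
    have "(a x + b x) * (a x - b x) = 2 * \<bar>outer_sign ?C (x $ i)\<bar> - 1" for x
      by (auto simp: a_def b_def outer_sign_def)
    then show ?thesis
      using has_bochner_integral_gauss_coord[OF abs_os, of i] prob_space
      by (simp add: gauss_inner_def has_bochner_integral_iff)
  qed
  ultimately show thesis
    using that[OF signs] by (simp add: opt_value_def)
qed

theorem theorem4p1: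
  fixes \<epsilon> :: real
    and A_DR A_\<epsilon> :: "(real ^ 'n \<Rightarrow> real) \<Rightarrow> real ^ 'n \<Rightarrow> real"
  assumes "\<epsilon> > 0"
    and "A_DR = (\<lambda>f x. hermite_proj 1 f x - lambda_star * f x)"
    and "A_\<epsilon> = (\<lambda>f x. hermite_proj 1 f x - lambda_star * f x - \<epsilon> * hermite_proj 3 f x)"
  shows "val A_\<epsilon> \<le> val A_DR - \<epsilon> * (0.046 - 12 * (2 * \<epsilon>) powr (1 / 4))"
proof -
  let ?S = "sign_functions :: (real ^ 'n \<Rightarrow> real) set"
  obtain f0 g0 :: "real ^ 'n \<Rightarrow> real" where opt: "f0 \<in> ?S" "g0 \<in> ?S"
    "level 1 f0 g0 - lambda_star * gauss_inner f0 g0 = opt_value"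
    by (rule opt_value_attained)
  have DR: "gauss_inner (A_DR f) g = level 1 f g - lambda_star * gauss_inner f g"
    and eps: "gauss_inner (A_\<epsilon> f) g = level 1 f g - lambda_star * gauss_inner f g - \<epsilon> * level 3 f g"
    if "f \<in> ?S" "g \<in> ?S" for f g
    unfolding assms(2,3) using that by (simp_all only: gauss_inner_operator sign_functions_unit)
  have "opt_value \<le> val A_DR"
    unfolding val_def
  proof (rule cSUP_upper2)
    \<comment> \<open>A supremum of reals dominates its members only for a bounded family; the upper
      bound for aligned pairs supplies this.\<close>
    show "bdd_above ((\<lambda>(f, g). gauss_inner (A_DR f) g) ` (?S \<times> ?S))"
      by (rule bdd_aboveI[of _ opt_value]) (auto simp: DR simp del: One_nat_def intro: aligned_pair)
    show "(f0, g0) \<in> ?S \<times> ?S"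
      using opt by simp
    show "opt_value \<le> (case (f0, g0) of (f, g) \<Rightarrow> gauss_inner (A_DR f) g)"
      unfolding prod.case DR[OF opt(1,2)] opt(3) ..
  qed
  moreover have "val A_\<epsilon> \<le> opt_value - \<epsilon> * (0.046 - 12 * (2 * \<epsilon>) powr (1 / 4))"
    unfolding val_def
  proof (rule cSUP_least)
    show "?S \<times> ?S \<noteq> {}"
      using opt by blast
    fix fg assume "fg \<in> ?S \<times> ?S"
    then obtain f g where fg: "fg = (f, g)" "f \<in> ?S" "g \<in> ?S"
      by blast
    show "(case fg of (f, g) \<Rightarrow> gauss_inner (A_\<epsilon> f) g) \<le> opt_value - \<epsilon> * (0.046 - 12 * (2 * \<epsilon>) powr (1 / 4))"
      unfolding fg(1) prod.case eps[OF fg(2,3)] by (rule aligned_pair(2)[OF fg(2,3) assms(1)])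
  qed
  ultimately show ?thesis
    by linarith
qed

end
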